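(* Consider the standard cylinder $Z=\mathbb D^2\times\mathbb R$ over the closed unit disc, as a billiard table in $\mathbb R^3$ with the standard contact structure $\xi_{\mathrm{std}}$ and metric $g_{\mathrm{std}}$. Given any regular $n$-gon inscribed in $\mathbb D^2$, and any integer $m$ coprime to $n$, there exists, up to $z$-translation, a unique billiard trajectory $\gamma$ in $Z$ such that: - $\pi\circ\gamma$ is comprised of $n$ circular segments with vertices in the $n$-gon; - consecutive vertices of $\pi\circ\gamma$ are obtained by a rotation of angle $\frac{2\pi m}{n}$.
   Context: On $\mathbb R^3$ let $\alpha=dz-\tfrac12(x\,dy-y\,dx)=dz-\tfrac12r^2d\theta$, $\xi_{\mathrm{std}}=\ker\alpha$, and $g_{\mathrm{std}}=dx^2+dy^2$ restricted to $\xi_{\mathrm{std}}$. Write covectors as $\lambda=a\alpha+b\,dx+c\,dy$; the dual norm is $H(\lambda)=\sqrt{b^2+c^2}$ and $S=\{b^2+c^2=1\}$. Geodesics parametrised by arclength are the projections to $\mathbb R^3$ of Hamiltonian orbits of $H$ in $S$; $a$ is constant along them, and with $\pi(x,y,z)=(x,y)$ their projections to the plane are circular arcs of curvature $a$ (straight segments if $a=0$). A curve tangent to $\xi_{\mathrm{std}}$ is recovered from its projection, up to initial height, by $\Delta z=\int\frac12r^2d\theta$, the signed area bounded by the projection (closed up by radial segments to the origin). A billiard trajectory in a table $W\subset\mathbb R^3$ is a curve in $W$, parametrised by arclength, consisting of geodesic segments between reflection points on $\partial W$, such that at each reflection point $q$ the ingoing and outgoing momenta $\lambda_{\rm in}\ne\lambda_{\rm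 out}\in S\cap T_q^*\mathbb R^3$ satisfy $\lambda_{\rm in}-\lambda_{\rm out}\in\mathrm{Ann}(T_q\partial W)$. (For $W=Z$: $a$ is preserved and the planar projection reflects elastically at $\partial\mathbb D^2$.) The statement belongs to the paper's description of the periodic billiard orbits of $Z$, whose circular arcs each enclose zero signed area. *)

theory Defs
  imports "HOL-Analysis.Analysis"
begin

section \<open>The standard contact structure and its cotangent Hamiltonian\<close>

type_synonym R3 = "real \<times> real \<times> real"

definition contact_form :: "R3 \<Rightarrow> R3 \<Rightarrow> real" where
  "contact_form = (\<lambda>(x, y, z) (u, v, w). w - (x * v - y * u) / 2)"

definition xi_std :: "R3 \<Rightarrow> R3 set" where
  "xi_std q = {v. contact_form q v = 0}"

definition g_std :: "R3 \<Rightarrow> R3 \<Rightarrow> real" where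
  "g_std = (\<lambda>(u, v, w) (u', v', w'). u * u' + v * v')"

text \<open>
  A covector is identified with its coefficients in the coordinate coframe dx, dy, dz, so that
  it acts on tangent vectors by the Euclidean inner product. The Hamiltonian is the norm dual
  to \<^const>\<open>g_std\<close> on \<^const>\<open>xi_std\<close>.
\<close>

definition dual_norm :: "R3 \<Rightarrow> R3 \<Rightarrow> real" where
  "dual_norm q l = (SUP v \<in> {v \<in> xi_std q. g_std v v \<le> 1}. l \<bullet> v)"

text \<open>
  The next two facts express the dual norm through the coefficients a, b, c of a covector in the
  coframe formed by the contact form, dx and dy: there \<open>a = lz\<close>, \<open>b = lx - lz * y / 2\<close> and
  \<open>c = ly + lz * x / 2\<close>.
\<close>

lemma covector_coframe:
  "(lx, ly, lz) \<bullet> (u, v, w)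
     = lz * contact_form (x, y, z) (u, v, w) + (lx - lz * y / 2) * u + (ly + lz * x / 2) * v"
  by (simp add: contact_form_def field_simps)

lemma dual_norm_eq:
  "dual_norm (x, y, z) (lx, ly, lz) = sqrt ((lx - lz * y / 2)\<^sup>2 + (ly + lz * x / 2)\<^sup>2)"
proof -
  define b where "b = lx - lz * y / 2"
  define c where "c = ly + lz * x / 2"
  define N where "N = sqrt (b\<^sup>2 + c\<^sup>2)"
  let ?A = "{v \<in> xi_std (x, y, z). g_std v v \<le> 1}"
  have ub: "(lx, ly, lz) \<bullet> v \<le> N" if "v \<in> ?A" for v
  proof -
    obtain v1 v2 v3 where v: "v = (v1, v2, v3)" by (cases v)
    have "contact_form (x, y, z) v = 0" and n1: "v1\<^sup>2 + v2\<^sup>2 \<le> 1"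
      using that by (auto simp: xi_std_def g_std_def v power2_eq_square)
    then have "(lx, ly, lz) \<bullet> v = (b, c) \<bullet> (v1, v2)"
      unfolding v covector_coframe[of lx ly lz v1 v2 v3 x y z] by (simp add: b_def c_def)
    also have "\<dots> \<le> norm (b, c) * norm (v1, v2)"
      by (rule norm_cauchy_schwarz)
    also have "\<dots> \<le> norm (b, c) * 1"
      using n1 by (intro mult_left_mono) (auto simp: norm_Pair)
    finally show ?thesis by (simp add: norm_Pair N_def)
  qed
  have attained: "\<exists>v \<in> ?A. (lx, ly, lz) \<bullet> v = N"
  proof -
    have NN: "N * N = b * b + c * c" and N0: "N \<ge> 0"
      by (auto simp: N_def power2_eq_square)
    let ?u = "b / N" and ?v = "c / N"
    let ?V = "(?u, ?v, (x * ?v - y * ?u) / 2)"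
    have le: "?u * ?u + ?v * ?v \<le> 1"
      using NN by (cases "N = 0") (simp_all add: add_divide_distrib [symmetric])
    have cf: "contact_form (x, y, z) ?V = 0"
      by (simp add: contact_form_def)
    have "(lx, ly, lz) \<bullet> ?V = b * ?u + c * ?v"
      unfolding covector_coframe[of lx ly lz _ _ _ x y z] cf by (simp add: b_def c_def)
    also have "\<dots> = N"
      using NN by (cases "N = 0") (simp_all add: add_divide_distrib [symmetric] field_simps)
    finally show ?thesis
      using le cf by (intro bexI[of _ ?V]) (auto simp: xi_std_def g_std_def)
  qed
  have "dual_norm (x, y, z) (lx, ly, lz) = N"
    unfolding dual_norm_def
  proof (rule cSup_eq_maximum)
    show "N \<in> (\<bullet>) (lx, ly, lz) ` ?A" using attained by force
  qed (use ub in auto)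
  then show ?thesis by (simp add: N_def b_def c_def)
qed

text \<open>
  Hamilton's equations at time \<open>t\<close>: \<open>dH (u, w) = q' \<bullet> w - p' \<bullet> u\<close> says that
  \<open>q'\<close> is the partial gradient of \<open>H\<close> in the momentum and \<open>-p'\<close> that in the position.
\<close>

definition hamilton_at ::
  "(R3 \<times> R3 \<Rightarrow> real) \<Rightarrow> (real \<Rightarrow> R3) \<Rightarrow> (real \<Rightarrow> R3) \<Rightarrow> real \<Rightarrow> bool" where
  "hamilton_at H q p t \<longleftrightarrow>
     (\<exists>q' p'. (q has_vector_derivative q') (at t) \<and> (p has_vector_derivative p') (at t) \<and>
        (H has_derivative (\<lambda>(u, w). q' \<bullet> w - p' \<bullet> u)) (at (q t, p t)))"


section \<open>Billiard trajectories\<close>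

text \<open>Tangent vectors of a smooth hypersurface, as velocities of curves lying in it.\<close>

definition tangent_vectors :: "R3 set \<Rightarrow> R3 \<Rightarrow> R3 set" where
  "tangent_vectors M q =
     {v. \<exists>c. (\<forall>s. c s \<in> M) \<and> c (0::real) = q \<and> (c has_vector_derivative v) (at 0)}"

definition annihilator :: "R3 set \<Rightarrow> R3 set" where
  "annihilator T = {l. \<forall>v \<in> T. l \<bullet> v = 0}"

text \<open>
  \<open>R\<close> is the set of reflection times. Away from \<open>R\<close> the curve is the projection of a Hamiltonian
  orbit in the unit level set, hence a geodesic parametrised by arclength. The ingoing and outgoing
  momenta are the one-sided limits of \<open>p\<close>; its values at the times in \<open>R\<close> are irrelevant.
\<close>

definition billiard_trajectory :: "R3 set \<Rightarrow> real set \<Rightarrow> (real \<Rightarrow> R3) \<Rightarrow> bool" where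
  "billiard_trajectory W R \<gamma> \<longleftrightarrow>
     continuous_on UNIV \<gamma> \<and> range \<gamma> \<subseteq> W \<and> (\<forall>s u. finite (R \<inter> {s..u})) \<and>
     (\<exists>p.
        (\<forall>t. t \<notin> R \<longrightarrow>
           dual_norm (\<gamma> t) (p t) = 1 \<and> hamilton_at (\<lambda>(q, l). dual_norm q l) \<gamma> p t) \<and>
        (\<forall>t \<in> R. \<gamma> t \<in> frontier W \<and>
           (\<exists>l_in l_out.
              (p \<longlongrightarrow> l_in) (at_left t) \<and> (p \<longlongrightarrow> l_out) (at_right t) \<and>
              dual_norm (\<gamma> t) l_in = 1 \<and> dual_norm (\<gamma> t) l_out = 1 \<and> l_in \<noteq> l_out \<and>
              l_in - l_out \<in> annihilator (tangent_vectors (frontier W) (\<gamma> t)))))"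

definition std_cylinder :: "R3 set" where
  "std_cylinder = {(x, y, z). x\<^sup>2 + y\<^sup>2 \<le> 1}"


section \<open>Closed trajectories over a regular polygon\<close>

text \<open>The plane is identified with the complex numbers, so rotations are products with \<^const>\<open>cis\<close>.\<close>

definition planar_proj :: "R3 \<Rightarrow> complex" where
  "planar_proj = (\<lambda>(x, y, z). Complex x y)"

text \<open>The vertex set of a regular \<open>n\<close>-gon inscribed in the closed unit disc.\<close>

definition inscribed_regular_ngon :: "nat \<Rightarrow> complex set \<Rightarrow> bool" where
  "inscribed_regular_ngon n V \<longleftrightarrow>
     (\<exists>v. cmod v = 1 \<and> V = (\<lambda>k. cis (2 * pi * real k / real n) * v) ` {..<n})"

text \<open>A unit speed arc of constant curvature \<open>\<kappa>\<close>, with a straight segment as the case \<open>\<kappa> = 0\<close>.\<close>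

definition circular_segment :: "(real \<Rightarrow> complex) \<Rightarrow> real \<Rightarrow> real \<Rightarrow> bool" where
  "circular_segment c s u \<longleftrightarrow>
     (\<exists>\<kappa> \<theta>. \<forall>t \<in> {s..u}. (c has_vector_derivative cis (\<theta> + \<kappa> * t)) (at t within {s..u}))"

text \<open>
  Closed billiard trajectories of the cylinder, of period \<open>T\<close>, with reflection times
  \<open>\<dots> < \<tau> 0 < \<tau> 1 < \<dots>\<close>, of which each period contains \<open>n\<close>. Closedness in space, not just of
  the planar projection, is essential: without it the curvature of the arcs would be a free parameter.
\<close>

definition ngon_trajectory :: "nat \<Rightarrow> int \<Rightarrow> complex set \<Rightarrow> (real \<Rightarrow> R3) \<Rightarrow> bool" where
  "ngon_trajectory n m V \<gamma> \<longleftrightarrow>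
     (\<exists>(\<tau> :: int \<Rightarrow> real) T.
        strict_mono \<tau> \<and> billiard_trajectory std_cylinder (range \<tau>) \<gamma> \<and>
        T > 0 \<and> (\<forall>t. \<gamma> (t + T) = \<gamma> t) \<and> (\<forall>k. \<tau> (k + int n) = \<tau> k + T) \<and>
        (\<forall>k. circular_segment (planar_proj \<circ> \<gamma>) (\<tau> k) (\<tau> (k + 1)) \<and>
             planar_proj (\<gamma> (\<tau> k)) \<in> V \<and>
             planar_proj (\<gamma> (\<tau> (k + 1)))
               = cis (2 * pi * real_of_int m / real n) * planar_proj (\<gamma> (\<tau> k))))"

end

(* Write 2 phi, with 0 < phi < pi, for the angle of the rotation modulo 2 pi. A circular arc in the
   disc over the chord from P to cis (2 phi) P, not gliding along the boundary, is determined by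
   half its turning angle beta in (phi - pi, phi): it leaves P at the angle phi + pi/2 - beta to the
   radius and arrives with the mirror image of that direction. Along the cylinder the annihilator
   consists of the radial covectors, so a reflection preserves the tangential component
   cos (phi - beta) of the direction; hence all arcs of a trajectory have the same beta and are
   congruent. They all gain the same height sin phi (cos phi + sin phi g(beta)), where
   g(beta) = (beta - sin beta cos beta) / sin^2 beta is strictly increasing on (-pi, pi).
   The trajectory closes up iff this height is zero, and the height is negative at phi - pi and
   positive at phi, so exactly one beta remains. Since m is coprime to n, a shift of time along the
   arcs then accounts for the choice of the first vertex. *)
theory Submission
  imports Defs "HOL-Real_Asymp.Real_Asymp"
begin

text \<open>The parameter is half the turning angle rather than the curvature
  \<open>sin \<beta> / sin \<phi>\<close>, because a minor and a major arc over one chord can have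
  the same curvature; the tangential velocity \<open>cos (\<phi> - \<beta>)\<close> separates them.
  The two ends of the range of \<beta> are the arcs of the unit circle itself, run counterclockwise
  and clockwise. Their lifts gain \<phi> and \<phi> - pi, half the signed angle swept, and this is
  where the signs for the intermediate value argument come from. The obstacle to uniqueness is a
  launch tangent to the circle, since staying in the disc only gives a weak inequality. Strict
  inwardness comes from the reflection law: momenta that differ but share the third coefficient and
  the tangential velocity must have opposite, nonzero radial velocities. A strictly inward launch in
  turn keeps the total turning below 2 pi, so that chord length and chord direction can be read off
  from the arc without sign ambiguity.\<close>

section \<open>Arcs over a chord of the unit circle\<close>

text \<open>The arc of curvature \<open>\<kappa>\<close> leaving \<open>1\<close> in the unit direction \<open>w\<close>, and the height of its horizontal lift.\<close>

definition arc_point :: "real \<Rightarrow> complex \<Rightarrow> real \<Rightarrow> complex" where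
  "arc_point \<kappa> w s = (if \<kappa> = 0 then 1 + of_real s * w else 1 + w * (cis (\<kappa> * s) - 1) / (\<i> * of_real \<kappa>))"

definition arc_height :: "real \<Rightarrow> complex \<Rightarrow> real \<Rightarrow> real" where
  "arc_height \<kappa> w s =
     (if \<kappa> = 0 then s * Im w / 2
      else (Re (w - w * cis (\<kappa> * s)) / \<kappa> + s / \<kappa> - sin (\<kappa> * s) / \<kappa>\<^sup>2) / 2)"

lemma arc_point_0 [simp]: "arc_point \<kappa> w 0 = 1" and arc_height_0 [simp]: "arc_height \<kappa> w 0 = 0"
  by (simp_all add: arc_point_def arc_height_def)

lemma has_vector_derivative_cis [derivative_intros]:
  assumes "(f has_real_derivative f') (at t within S)"
  shows "((\<lambda>t. cis (f t)) has_vector_derivative (of_real f' * (\<i> * cis (f t)))) (at t within S)"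
  using has_derivative_cis[OF assms[unfolded has_field_derivative_def]]
  unfolding has_vector_derivative_def by (simp add: scaleR_conv_of_real mult_ac)

lemma arc_point_has_vector_derivative:
  "(arc_point \<kappa> w has_vector_derivative (w * cis (\<kappa> * s))) (at s within S)"
proof (cases "\<kappa> = 0")
  case True
  have "((\<lambda>s. 1 + of_real s * w) has_vector_derivative w) (at s within S)"
    by (auto intro!: derivative_eq_intros)
  then show ?thesis
    using True by (simp add: arc_point_def[abs_def])
next
  case False
  have "((\<lambda>s. 1 + w * (cis (\<kappa> * s) - 1) / (\<i> * of_real \<kappa>)) has_vector_derivative (w * cis (\<kappa> * s))) (at s within S)"
    using False by (auto intro!: derivative_eq_intros simp: complex_eq_iff)
  then show ?thesis
    using False by (simp add: arc_point_def[abs_def])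
qed

lemma arc_height_has_derivative:
  assumes "cmod w = 1"
  shows "(arc_height \<kappa> w has_real_derivative Im (cnj (arc_point \<kappa> w s) * (w * cis (\<kappa> * s))) / 2) (at s within S)"
proof (cases "\<kappa> = 0")
  case True
  have w: "Re w * Re w + Im w * Im w = 1"
    using assms by (simp add: cmod_def power2_eq_square)
  have "((\<lambda>s. s * Im w / 2) has_real_derivative (Im w / 2)) (at s within S)"
    by (auto intro!: derivative_eq_intros)
  then show ?thesis
    using True by (simp add: arc_height_def[abs_def] arc_point_def algebra_simps)
next
  case False
  have w: "Re w * Re w + Im w * Im w = 1"
    using assms by (simp add: cmod_def power2_eq_square)
  let ?C = "cos (\<kappa> * s)" and ?S = "sin (\<kappa> * s)"
  have cs: "?C * ?C + ?S * ?S = 1" by (simp flip: power2_eq_square)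
  have A: "arc_point \<kappa> w s = 1 + w * (cis (\<kappa> * s) - 1) * (- \<i> * of_real (1 / \<kappa>))"
    using False by (simp add: arc_point_def field_simps)
  have *: "Im (cnj (arc_point \<kappa> w s) * (w * cis (\<kappa> * s))) = Re w * ?S + Im w * ?C + (1 - ?C) / \<kappa>"
  proof -
    have "Im (cnj (arc_point \<kappa> w s) * (w * cis (\<kappa> * s))) =
       Re w * ?S + Im w * ?C + (Re w * Re w + Im w * Im w) * (?C * ?C + ?S * ?S - ?C) * (1 / \<kappa>)"
      unfolding A by (simp del: of_real_divide of_real_inverse sin_cos_squared_add3 add: algebra_simps)
    then show ?thesis unfolding w cs by simp
  qed
  have "((\<lambda>s. (Re (w - w * cis (\<kappa> * s)) / \<kappa> + s / \<kappa> - sin (\<kappa> * s) / \<kappa>\<^sup>2) / 2)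
     has_real_derivative (Re w * ?S + Im w * ?C + (1 - ?C) / \<kappa>) / 2) (at s within S)"
    using False by (auto intro!: derivative_eq_intros simp: field_simps power2_eq_square)
  then show ?thesis
    unfolding * using False by (simp add: arc_height_def[abs_def])
qed

text \<open>The half-angle identity splits the displacement into a real chord length and the chord
  direction, which is the tangent direction halfway along the arc. Lengths and directions can then
  be compared separately.\<close>

lemma arc_point_eq:
  "\<kappa> \<noteq> 0 \<Longrightarrow> arc_point \<kappa> w s = 1 + of_real (2 * sin (\<kappa> * s / 2) / \<kappa>) * (w * cis (\<kappa> * s / 2))"
proof -
  assume k: "\<kappa> \<noteq> 0"
  define u where "u = \<kappa> * s / 2"
  have "cis (2 * u) - 1 = 2 * \<i> * of_real (sin u) * cis u"
    by (simp add: complex_eq_iff cos_double_sin sin_double power2_eq_square)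
  moreover have "\<kappa> * s = 2 * u" by (simp add: u_def)
  ultimately show ?thesis
    using k by (simp add: arc_point_def flip: u_def)
qed

section \<open>Arcs over a fixed chord\<close>

text \<open>
  A chord subtending the angle \<open>2 * \<phi>\<close> of the unit circle has length \<open>2 * sin \<phi>\<close>. The arc over it
  that turns by \<open>2 * \<beta>\<close> has curvature \<open>sin \<beta> / sin \<phi>\<close>.
\<close>

definition arc_length :: "real \<Rightarrow> real \<Rightarrow> real" where
  "arc_length \<phi> \<beta> = (if \<beta> = 0 then 2 * sin \<phi> else 2 * \<beta> * sin \<phi> / sin \<beta>)"

text \<open>
  The signed area between the chord and the arc, over the square of half the chord. The
  junk value at \<open>\<beta> = 0\<close> is the correct continuous extension \<open>0\<close>.
\<close>

definition area_ratio :: "real \<Rightarrow> real" where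
  "area_ratio \<beta> = (\<beta> - sin \<beta> * cos \<beta>) / (sin \<beta>)\<^sup>2"

text \<open>The angle \<open>\<phi> + pi / 2\<close> is the direction of the chord from 1 to
  \<open>cis (2 * \<phi>)\<close>. The launch is turned back from it by \<beta>, so that it meets
  the chord direction halfway.\<close>

abbreviation launch :: "real \<Rightarrow> real \<Rightarrow> complex" where
  "launch \<phi> \<beta> \<equiv> cis (\<phi> + pi / 2 - \<beta>)"

lemma cmod_one_plus_cis_sq: "(cmod (1 + of_real r * cis x))\<^sup>2 = 1 + 2 * r * cos x + r\<^sup>2"
proof -
  have "(cmod (1 + of_real r * cis x))\<^sup>2 = 1 + 2 * r * cos x + r\<^sup>2 * ((cos x)\<^sup>2 + (sin x)\<^sup>2)"
    unfolding cmod_power2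
    by (simp add: power2_eq_square algebra_simps
        del: sin_cos_squared_add sin_cos_squared_add2 sin_cos_squared_add3)
  then show ?thesis by simp
qed

lemma cis_double_minus_one: "cis (2 * \<phi>) - 1 = of_real (2 * sin \<phi>) * cis (\<phi> + pi / 2)"
  by (simp add: complex_eq_iff sin_double cos_double_sin cos_add sin_add power2_eq_square)

lemma sin_div_pos:
  fixes \<beta> :: real
  assumes "\<bar>\<beta>\<bar> < pi" "\<beta> \<noteq> 0"
  shows "\<beta> / sin \<beta> > 0"
proof (cases "\<beta> > 0")
  case True
  then show ?thesis using assms sin_gt_zero[of \<beta>] by simp
next
  case False
  then show ?thesis using assms sin_gt_zero[of "-\<beta>"] by (simp add: divide_neg_neg)
qed

text \<open>The bounds on \<beta> express a strictly inward launch at 1: its radial component is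
  \<open>- sin (\<phi> - \<beta>)\<close>, and they say that \<open>\<phi> - \<beta>\<close> lies in
  (0, pi).\<close>

locale chord =
  fixes \<phi> \<beta> :: real
  assumes phi: "0 < \<phi>" "\<phi> < pi" and beta: "\<phi> - pi < \<beta>" "\<beta> < \<phi>"
begin

abbreviation "\<kappa> \<equiv> sin \<beta> / sin \<phi>"
abbreviation "L \<equiv> arc_length \<phi> \<beta>"
abbreviation "w \<equiv> launch \<phi> \<beta>"

lemma sin_phi: "sin \<phi> > 0" using phi by (rule sin_gt_zero)

lemma beta_pi: "\<bar>\<beta>\<bar> < pi" using phi beta by auto

lemma sin_beta: "sin \<beta> = 0 \<longleftrightarrow> \<beta> = 0"
  using sin_div_pos[OF beta_pi] by force

lemma L_pos: "L > 0"
proof (cases "\<beta> = 0")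
  case False
  then have "L = 2 * (\<beta> / sin \<beta> * sin \<phi>)" by (simp add: arc_length_def)
  then show ?thesis using sin_div_pos[OF beta_pi False] sin_phi by (metis mult_pos_pos zero_less_numeral)
qed (simp add: arc_length_def sin_phi)

lemma curvature_length: "\<kappa> * L = 2 * \<beta>"
  using sin_phi sin_beta by (simp add: arc_length_def)

lemma arc_end: "arc_point \<kappa> w L = cis (2 * \<phi>)"
proof -
  have *: "cis (2 * \<phi>) = 1 + of_real (2 * sin \<phi>) * cis (\<phi> + pi / 2)"
    using cis_double_minus_one[of \<phi>] by (simp add: algebra_simps)
  show ?thesis
  proof (cases "\<beta> = 0")
    case True
    then show ?thesis by (simp add: arc_point_def * arc_length_def)
  next
    case False
    then have k: "\<kappa> \<noteq> 0" using sin_beta sin_phi by simp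
    show ?thesis using sin_phi sin_beta False
      by (simp only: arc_point_eq[OF k] curvature_length *) (simp add: cis_mult)
  qed
qed

text \<open>Sum of two signed areas: \<open>sin \<phi> * cos \<phi>\<close> is the triangle on 0, 1
  and \<open>cis (2 * \<phi>)\<close>, and the rest is the region between chord and arc, the half
  chord being \<open>sin \<phi>\<close>.\<close>

lemma arc_height_end: "arc_height \<kappa> w L = sin \<phi> * (cos \<phi> + sin \<phi> * area_ratio \<beta>)"
proof (cases "\<beta> = 0")
  case True
  then show ?thesis by (simp add: arc_height_def arc_length_def area_ratio_def sin_add)
next
  case False
  then have b: "sin \<beta> \<noteq> 0" using sin_beta by simp
  have k: "\<kappa> \<noteq> 0" using b sin_phi by simp
  have "cos (\<phi> + pi / 2 - \<beta>) - cos (\<phi> + pi / 2 - \<beta> + 2 * \<beta>) = 2 * cos \<phi> * sin \<beta>"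
  proof -
    have 1: "\<phi> + pi / 2 - \<beta> = (\<phi> - \<beta>) + pi / 2"
      and 2: "\<phi> + pi / 2 - \<beta> + 2 * \<beta> = (\<phi> + \<beta>) + pi / 2" by auto
    have "cos (\<phi> + pi / 2 - \<beta>) = - sin (\<phi> - \<beta>)" by (simp only: 1 cos_add[of _ "pi / 2"]) simp
    moreover have "cos (\<phi> + pi / 2 - \<beta> + 2 * \<beta>) = - sin (\<phi> + \<beta>)"
      by (simp only: 2 cos_add[of _ "pi / 2"]) simp
    ultimately show ?thesis by (simp add: sin_add sin_diff)
  qed
  then have R: "Re (w - w * cis (2 * \<beta>)) = 2 * cos \<phi> * sin \<beta>"
    by (simp add: cis_mult)
  have "(2 * cos \<phi> * sin \<beta> / \<kappa> + 2 * \<beta> * sin \<phi> / sin \<beta> / \<kappa> - 2 * sin \<beta> * cos \<beta> / \<kappa>\<^sup>2) / 2 =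
      sin \<phi> * (cos \<phi> + sin \<phi> * ((\<beta> - sin \<beta> * cos \<beta>) / (sin \<beta>)\<^sup>2))"
    using sin_phi b by (simp add: divide_simps) (simp add: power2_eq_square algebra_simps)
  moreover have "L = 2 * \<beta> * sin \<phi> / sin \<beta>" using False by (simp add: arc_length_def)
  ultimately show ?thesis
    unfolding arc_height_def curvature_length R sin_double area_ratio_def using k by simp
qed

text \<open>With \<open>u\<close> half the angle turned so far, the squared modulus minus 1 factors
  into a nonnegative constant times \<open>sin u * sin (u - \<beta>)\<close>. The zeros
  \<open>u = 0\<close> and \<open>u = \<beta>\<close> are the ends of the arc on the circle, and
  between them the two sines have opposite signs. The straight case has the same shape, with the
  factors \<open>s\<close> and \<open>s - 2 * sin \<phi>\<close>.\<close>

lemma arc_in_disc: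
  assumes "0 \<le> s" "s \<le> L"
  shows "cmod (arc_point \<kappa> w s) \<le> 1"
proof (cases "\<beta> = 0")
  case True
  then have s: "s \<le> 2 * sin \<phi>" using assms by (simp add: arc_length_def)
  have "(cmod (arc_point \<kappa> w s))\<^sup>2 = 1 + s * (s - 2 * sin \<phi>)"
    using True cmod_one_plus_cis_sq[of s "\<phi> + pi / 2"]
    by (simp add: arc_point_def cos_add power2_eq_square algebra_simps)
  also have "\<dots> \<le> 1" using s assms by (simp add: mult_nonneg_nonpos)
  finally show ?thesis by (simp add: power_le_one_iff)
next
  case False
  then have b: "sin \<beta> \<noteq> 0" using sin_beta by simp
  have k: "\<kappa> \<noteq> 0" using b sin_phi by simp
  define u where "u = \<kappa> * s / 2"
  have S: "sin \<phi> * sin u - sin \<beta> * sin (\<phi> - \<beta> + u) = sin (\<phi> - \<beta>) * sin (u - \<beta>)"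
  proof -
    have "sin \<beta> * sin \<beta> = 1 - cos \<beta> * cos \<beta>" by (simp add: algebra_simps)
    then show ?thesis
      unfolding sin_add sin_diff cos_diff cos_add by algebra
  qed
  have "(cmod (arc_point \<kappa> w s))\<^sup>2 = 1 + 4 * sin u / \<kappa> * (cos (\<phi> + pi / 2 - \<beta> + u)) + 4 * (sin u)\<^sup>2 / \<kappa>\<^sup>2"
    unfolding arc_point_eq[OF k] u_def[symmetric] cis_mult cmod_one_plus_cis_sq
    by (simp add: power_divide power_mult_distrib)
  also have "cos (\<phi> + pi / 2 - \<beta> + u) = - sin (\<phi> - \<beta> + u)"
  proof -
    have "\<phi> + pi / 2 - \<beta> + u = (\<phi> - \<beta> + u) + pi / 2" by simp
    then show ?thesis by (simp only: cos_add) simp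
  qed
  also have "1 + 4 * sin u / \<kappa> * (- sin (\<phi> - \<beta> + u)) + 4 * (sin u)\<^sup>2 / \<kappa>\<^sup>2 =
      1 + 4 / (\<kappa>\<^sup>2 * sin \<phi>) * sin u * (sin \<phi> * sin u - sin \<beta> * sin (\<phi> - \<beta> + u))"
    using sin_phi b by (simp add: divide_simps) (simp add: power2_eq_square algebra_simps)
  also have "\<dots> = 1 + 4 / (\<kappa>\<^sup>2 * sin \<phi>) * sin (\<phi> - \<beta>) * (sin u * sin (u - \<beta>))"
    unfolding S by simp
  also have "\<dots> \<le> 1"
  proof -
    have "sin (\<phi> - \<beta>) > 0" using beta by (intro sin_gt_zero) auto
    then have "4 / (\<kappa>\<^sup>2 * sin \<phi>) * sin (\<phi> - \<beta>) \<ge> 0" using sin_phi by simp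
    moreover have "sin u * sin (u - \<beta>) \<le> 0"
    proof (cases "\<beta> > 0")
      case True
      have "sin \<beta> > 0" using True beta_pi sin_gt_zero by simp
      then have "\<kappa> > 0" using sin_phi by simp
      then have "0 \<le> u" "2 * u \<le> \<kappa> * L"
        using assms mult_left_mono[of s L \<kappa>] mult_nonneg_nonneg[of \<kappa> s] by (auto simp: u_def)
      then have "0 \<le> u" "u \<le> \<beta>" using curvature_length by auto
      then have "sin u \<ge> 0" "sin (\<beta> - u) \<ge> 0" using beta_pi by (auto intro!: sin_ge_zero)
      then show ?thesis
        using sin_minus[of "\<beta> - u"] by (simp add: mult_nonneg_nonpos)
    next
      case nb: False
      have "sin (-\<beta>) > 0" using nb False beta_pi by (intro sin_gt_zero) auto
      then have "\<kappa> < 0" using sin_phi by (simp add: divide_neg_pos)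
      then have "u \<le> 0" "2 * u \<ge> \<kappa> * L" 
        using assms mult_left_mono_neg[of s L \<kappa>] mult_nonpos_nonneg[of \<kappa> s] by (auto simp: u_def)
      then have "0 \<ge> u" "u \<ge> \<beta>" using curvature_length by auto
      then have "sin (- u) \<ge> 0" "sin (u - \<beta>) \<ge> 0"
        using beta_pi sin_ge_zero[of "- u"] sin_ge_zero[of "u - \<beta>"] by auto
      then show ?thesis
        by (simp add: mult_nonpos_nonneg)
    qed
    ultimately have "4 / (\<kappa>\<^sup>2 * sin \<phi>) * sin (\<phi> - \<beta>) * (sin u * sin (u - \<beta>)) \<le> 0"
      by (rule mult_nonneg_nonpos)
    then show ?thesis by linarith
  qed
  finally show ?thesis by (simp add: power_le_one_iff)
qed

end

section \<open>Recovering the half turning angle from an arc inside the disc\<close>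

lemma of_real_mult_unit_eq:
  fixes w z :: complex
  assumes "of_real r * w = of_real r' * z" "cmod w = 1" "cmod z = 1" "r > 0" "r' > 0"
  shows "r = r'" "w = z"
proof -
  show "r = r'"
    using arg_cong[OF assms(1), of cmod] assms(2-) by (simp add: norm_mult)
  then show "w = z" using assms by simp
qed

lemma cmod_sq_has_derivative:
  assumes "(c has_vector_derivative h) (at t within S)"
  shows "((\<lambda>t. (cmod (c t))\<^sup>2) has_real_derivative 2 * Re (cnj (c t) * h)) (at t within S)"
proof -
  have "((\<lambda>t. Re (c t)) has_real_derivative Re h) (at t within S)"
    "((\<lambda>t. Im (c t)) has_real_derivative Im h) (at t within S)"
    using bounded_linear.has_vector_derivative[OF bounded_linear_Re assms]
      bounded_linear.has_vector_derivative[OF bounded_linear_Im assms]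
    by (simp_all add: has_real_derivative_iff_has_vector_derivative)
  from DERIV_add[OF DERIV_power[OF this(1), of 2] DERIV_power[OF this(2), of 2]]
  show ?thesis unfolding cmod_power2 by (simp add: algebra_simps)
qed

text \<open>An arc running through a full circle would come back to its inward start from outside the disc.\<close>

lemma arc_half_turning_lt_pi:
  assumes k: "\<kappa> \<noteq> 0" and w: "cmod w = 1" "Re w < 0"
    and disc: "\<And>r. 0 \<le> r \<Longrightarrow> r \<le> l \<Longrightarrow> cmod (arc_point \<kappa> w r) \<le> 1"
  shows "\<bar>\<kappa>\<bar> * l < 2 * pi"
proof (rule ccontr)
  assume neg: "\<not> \<bar>\<kappa>\<bar> * l < 2 * pi"
  define t where "t = 2 * pi / \<bar>\<kappa>\<bar>"
  have t: "0 < t" "t \<le> l"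
    using neg k by (auto simp: t_def field_simps)
  have "\<kappa> * t = 2 * pi \<or> \<kappa> * t = - (2 * pi)"
    using k by (auto simp: t_def abs_if)
  then have c: "cis (\<kappa> * t) = 1"
    by (auto simp: complex_eq_iff)
  then have a: "arc_point \<kappa> w t = 1"
    using k by (simp add: arc_point_def)
  have "((\<lambda>r. (cmod (arc_point \<kappa> w r))\<^sup>2) has_real_derivative 2 * Re w) (at t)"
    using cmod_sq_has_derivative[OF arc_point_has_vector_derivative[of \<kappa> w t UNIV]] by (simp add: a c)
  from DERIV_neg_dec_left[OF this] w(2) obtain d where d: "d > 0"
    "\<And>h. 0 < h \<Longrightarrow> h < d \<Longrightarrow> (cmod (arc_point \<kappa> w t))\<^sup>2 < (cmod (arc_point \<kappa> w (t - h)))\<^sup>2"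
    by auto
  define h where "h = min (d / 2) t"
  have "0 < h" "h < d" using t d(1) by (auto simp: h_def)
  then have "1 < (cmod (arc_point \<kappa> w (t - h)))\<^sup>2"
    using d(2)[of h] a by simp
  moreover have "cmod (arc_point \<kappa> w (t - h)) \<le> 1"
    using t d(1) by (intro disc) (auto simp: h_def)
  then have "(cmod (arc_point \<kappa> w (t - h)))\<^sup>2 \<le> 1" by (simp add: power_le_one_iff)
  ultimately show False by simp
qed

text \<open>Take \<beta> to be half the total turning \<open>\<kappa> * l\<close>. Since it is below
  pi in modulus, \<open>\<beta> / sin \<beta>\<close> and hence
  \<open>sin \<beta> / \<kappa>\<close> are positive, so equating polar forms of the displacement
  yields both the chord length and the launch direction. A priori \<open>\<phi> - \<beta>\<close>
  lies in (-pi, 2 pi); the inward launch makes its sine positive and cuts this down to (0,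
  pi).\<close>

lemma arc_launch:
  assumes phi: "0 < \<phi>" "\<phi> < pi" and l: "l > 0" and w: "cmod w = 1" "Re w < 0"
    and disc: "\<And>r. 0 \<le> r \<Longrightarrow> r \<le> l \<Longrightarrow> cmod (arc_point \<kappa> w r) \<le> 1"
    and fin: "arc_point \<kappa> w l = cis (2 * \<phi>)"
  obtains \<beta> where "\<phi> - pi < \<beta>" "\<beta> < \<phi>" "l = arc_length \<phi> \<beta>" "\<kappa> = sin \<beta> / sin \<phi>" "w = launch \<phi> \<beta>"
proof (cases "\<kappa> = 0")
  case True
  have sp: "sin \<phi> > 0" using phi by (rule sin_gt_zero)
  have "of_real l * w = of_real (2 * sin \<phi>) * cis (\<phi> + pi / 2)"
    using fin True cis_double_minus_one[of \<phi>] by (simp add: arc_point_def algebra_simps)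
  from of_real_mult_unit_eq[OF this] l w sp have "l = 2 * sin \<phi>" "w = cis (\<phi> + pi / 2)" by auto
  then show ?thesis using phi True by (intro that[of 0]) (auto simp: arc_length_def)
next
  case False
  have sp: "sin \<phi> > 0" using phi by (rule sin_gt_zero)
  define \<beta> where "\<beta> = \<kappa> * l / 2"
  have b0: "\<beta> \<noteq> 0" using False l by (simp add: \<beta>_def)
  have bpi: "\<bar>\<beta>\<bar> < pi"
    using arc_half_turning_lt_pi[OF False w disc, of l] l by (simp add: \<beta>_def abs_mult)
  have "\<beta> / sin \<beta> > 0" by (rule sin_div_pos) fact+
  then have "l / 2 / (\<beta> / sin \<beta>) > 0" using l divide_pos_pos[of "l / 2" "\<beta> / sin \<beta>"] by auto
  moreover have "l / 2 / (\<beta> / sin \<beta>) = sin \<beta> / \<kappa>"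
    using False l b0 by (simp add: \<beta>_def)
  ultimately have p: "2 * sin \<beta> / \<kappa> > 0" by simp
  have "of_real (2 * sin \<beta> / \<kappa>) * (w * cis \<beta>) = of_real (2 * sin \<phi>) * cis (\<phi> + pi / 2)"
    using fin cis_double_minus_one[of \<phi>] unfolding arc_point_eq[OF False] \<beta>_def by (simp add: algebra_simps)
  from of_real_mult_unit_eq[OF this] p w sp
  have 1: "2 * sin \<beta> / \<kappa> = 2 * sin \<phi>" and 2: "w * cis \<beta> = cis (\<phi> + pi / 2)"
    by (auto simp: norm_mult)
  have k: "\<kappa> = sin \<beta> / sin \<phi>" using 1 False sp by (simp add: field_simps)
  have "w = w * cis \<beta> * cis (- \<beta>)" by (simp only: mult.assoc cis_mult) simp
  also have "\<dots> = launch \<phi> \<beta>" unfolding 2 cis_mult by simp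
  finally have wl: "w = launch \<phi> \<beta>" .
  have "\<phi> + pi / 2 - \<beta> = (\<phi> - \<beta>) + pi / 2" by simp
  then have "Re w = - sin (\<phi> - \<beta>)"
    unfolding wl by (simp only: cis.sel cos_add) simp
  then have s: "sin (\<phi> - \<beta>) > 0" using w by simp
  have "\<beta> < \<phi>"
  proof (rule ccontr)
    assume "\<not> \<beta> < \<phi>"
    then have "sin (\<beta> - \<phi>) \<ge> 0" using bpi phi by (intro sin_ge_zero) auto
    then show False using s sin_minus[of "\<phi> - \<beta>"] by simp
  qed
  moreover have "\<phi> - pi < \<beta>"
  proof (rule ccontr)
    assume "\<not> \<phi> - pi < \<beta>"
    then have "sin (\<phi> - \<beta> - pi) \<ge> 0" using bpi phi by (intro sin_ge_zero) auto
    then show False using s by (simp add: sin_diff)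
  qed
  moreover have "l = arc_length \<phi> \<beta>"
  proof -
    have "sin \<beta> \<noteq> 0" using p by auto
    then have "2 * \<beta> * sin \<phi> / sin \<beta> = 2 * \<beta> / \<kappa>" using k by simp
    then show ?thesis using b0 False by (simp add: arc_length_def \<beta>_def)
  qed
  ultimately show ?thesis using k wl by (intro that) auto
qed

section \<open>Unit speed curves of constant curvature as rotated arcs\<close>

lemma arc_point_shift_has_vector_derivative:
  "((\<lambda>t. arc_point \<kappa> w (t - s)) has_vector_derivative (w * cis (\<kappa> * (t - s)))) (at t within S)"
proof -
  have "((\<lambda>t. t - s) has_vector_derivative 1) (at t within S)"
    by (auto intro!: derivative_eq_intros)
  from vector_diff_chain_within[OF this arc_point_has_vector_derivative]
  show ?thesis by (simp add: o_def)
qed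

lemma arc_height_shift_has_derivative:
  assumes "cmod w = 1"
  shows "((\<lambda>t. arc_height \<kappa> w (t - s)) has_real_derivative
     Im (cnj (arc_point \<kappa> w (t - s)) * (w * cis (\<kappa> * (t - s)))) / 2) (at t within S)"
proof -
  have "((\<lambda>t. t - s) has_real_derivative 1) (at t within S)"
    by (auto intro!: derivative_eq_intros)
  from DERIV_chain2[OF arc_height_has_derivative[OF assms] this]
  show ?thesis by simp
qed

text \<open>Both sides agree at \<open>s\<close> and have the same derivative. Multiplying by
  \<open>cnj (c s)\<close> rotates the start to 1, where \<open>arc_point\<close> begins.\<close>

lemma constant_curvature_eq_arc:
  assumes deriv: "\<And>t. t \<in> {s..u} \<Longrightarrow> (c has_vector_derivative cis (\<theta> + \<kappa> * t)) (at t within {s..u})"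
    and cs: "cmod (c s) = 1" and t: "t \<in> {s..u}"
  shows "c t = c s * arc_point \<kappa> (cnj (c s) * cis (\<theta> + \<kappa> * s)) (t - s)"
proof -
  define w where "w = cnj (c s) * cis (\<theta> + \<kappa> * s)"
  have csw: "c s * w = cis (\<theta> + \<kappa> * s)"
  proof -
    have "c s * cnj (c s) = 1" using complex_norm_square[of "c s"] cs by simp
    then show ?thesis unfolding w_def mult.assoc[symmetric] by simp
  qed
  have "((\<lambda>t. c t - c s * arc_point \<kappa> w (t - s)) has_vector_derivative 0) (at t within {s..u})"
    if "t \<in> {s..u}" for t
  proof -
    have "c s * (w * cis (\<kappa> * (t - s))) = (c s * w) * cis (\<kappa> * (t - s))" by simp
    also have "\<dots> = cis (\<theta> + \<kappa> * s + \<kappa> * (t - s))" unfolding csw by (rule cis_mult)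
    also have "\<theta> + \<kappa> * s + \<kappa> * (t - s) = \<theta> + \<kappa> * t" by (simp add: algebra_simps)
    finally have *: "c s * (w * cis (\<kappa> * (t - s))) = cis (\<theta> + \<kappa> * t)" .
    from has_vector_derivative_diff[OF deriv[OF that]
        has_vector_derivative_mult_right[OF arc_point_shift_has_vector_derivative[of \<kappa> w s], of "c s"]]
    show ?thesis unfolding * by simp
  qed
  from has_vector_derivative_zero_constant[OF _ this]
  obtain d where d: "\<And>t. t \<in> {s..u} \<Longrightarrow> c t - c s * arc_point \<kappa> w (t - s) = d" by auto
  have "s \<in> {s..u}" using t by auto
  from d[OF this] have "d = 0" by simp
  then show ?thesis using d[OF t] by (simp add: w_def)
qed

section \<open>The height gained along an arc\<close>

lemma area_ratio_minus: "area_ratio (- \<beta>) = - area_ratio \<beta>"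
  by (simp add: area_ratio_def diff_divide_distrib)

text \<open>Gives the sign of the numerator in the derivative of \<open>area_ratio\<close>.\<close>

lemma x_cos_less_sin:
  fixes x :: real
  assumes "0 < x" "x < pi"
  shows "x * cos x < sin x"
proof -
  have "(\<lambda>x. sin x - x * cos x) 0 < (\<lambda>x. sin x - x * cos x) x"
  proof (rule DERIV_pos_imp_increasing_open[OF assms(1)])
    fix y assume "0 < y" "y < x"
    moreover have "((\<lambda>x. sin x - x * cos x) has_real_derivative y * sin y) (at y)"
      by (auto intro!: derivative_eq_intros)
    ultimately show "\<exists>d. ((\<lambda>x. sin x - x * cos x) has_real_derivative d) (at y) \<and> 0 < d"
      using assms sin_gt_zero[of y] by (intro exI[of _ "y * sin y"]) auto
  qed (auto intro!: continuous_intros)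
  then show ?thesis by simp
qed

lemma area_ratio_has_derivative:
  assumes "sin y \<noteq> 0"
  shows "(area_ratio has_real_derivative 2 * (sin y - y * cos y) / sin y ^ 3) (at y)"
proof -
  have "((\<lambda>\<beta>. (\<beta> - sin \<beta> * cos \<beta>) / (sin \<beta>)\<^sup>2) has_real_derivative
      ((1 - (cos y * cos y - sin y * sin y)) * (sin y)\<^sup>2 - (y - sin y * cos y) * (2 * sin y * cos y)) / ((sin y)\<^sup>2 * (sin y)\<^sup>2)) (at y)"
    using assms by (auto intro!: derivative_eq_intros simp: algebra_simps)
  also have "1 - (cos y * cos y - sin y * sin y) = 2 * (sin y * sin y)"
    using sin_cos_squared_add3[of y] by linarith
  also have "(2 * (sin y * sin y) * (sin y)\<^sup>2 - (y - sin y * cos y) * (2 * sin y * cos y)) / ((sin y)\<^sup>2 * (sin y)\<^sup>2)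
    = 2 * (sin y * (sin y * sin y + cos y * cos y) - y * cos y) / sin y ^ 3"
    using assms by (simp add: divide_simps del: sin_cos_squared_add3) (simp add: power2_eq_square power3_eq_cube power4_eq_xxxx algebra_simps del: sin_cos_squared_add3)
  also have "sin y * sin y + cos y * cos y = 1"
    using sin_cos_squared_add3[of y] by linarith
  finally show ?thesis by (simp add: area_ratio_def[abs_def])
qed

lemma area_ratio_strict_mono:
  assumes "0 < a" "a < b" "b < pi"
  shows "area_ratio a < area_ratio b"
proof (rule DERIV_pos_imp_increasing_open[OF assms(2)])
  fix y assume "a < y" "y < b"
  then have y: "0 < y" "y < pi" using assms by auto
  then have "sin y > 0" by (rule sin_gt_zero)
  then show "\<exists>d. (area_ratio has_real_derivative d) (at y) \<and> 0 < d"
    using area_ratio_has_derivative[of y] x_cos_less_sin[OF y]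
    by (intro exI[of _ "2 * (sin y - y * cos y) / sin y ^ 3"]) auto
next
  have "sin y \<noteq> 0" if "y \<in> {a..b}" for y using sin_gt_zero[of y] that assms by auto
  then show "continuous_on {a..b} area_ratio"
    by (meson DERIV_isCont area_ratio_has_derivative continuous_at_imp_continuous_on)
qed

lemma area_ratio_pos:
  assumes "0 < b" "b < pi"
  shows "area_ratio b > 0"
proof -
  have "cos b < 1" using cos_monotone_0_pi[of 0 b] assms by simp
  then have "sin b * cos b < sin b" using sin_gt_zero[OF assms] by simp
  also have "sin b \<le> b" using assms by (intro sin_x_le_x) auto
  finally have "sin b * cos b < b" .
  then show ?thesis using sin_gt_zero[OF assms] by (simp add: area_ratio_def)
qed

text \<open>The quotient formula for the derivative breaks down at 0, so monotonicity is obtained on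
  (0, pi), carried to (-pi, 0) by oddness, and joined across 0 by comparing signs.\<close>

lemma area_ratio_inj:
  assumes "\<bar>a\<bar> < pi" "\<bar>b\<bar> < pi" "area_ratio a = area_ratio b"
  shows "a = b"
proof -
  have less: "area_ratio a < area_ratio b" if "\<bar>a\<bar> < pi" "\<bar>b\<bar> < pi" "a < b" for a b
  proof -
    have z: "area_ratio 0 = 0" by (simp add: area_ratio_def)
    consider "0 < a" | "b < 0" | "a \<le> 0" "b \<ge> 0" by linarith
    then show ?thesis
    proof cases
      case 1 then show ?thesis using that by (intro area_ratio_strict_mono) auto
    next
      case 2
      then have "area_ratio (-b) < area_ratio (-a)" using that by (intro area_ratio_strict_mono) auto
      then show ?thesis by (simp add: area_ratio_minus)
    next
      case 3
      have "b > 0 \<Longrightarrow> area_ratio b > 0" using that by (intro area_ratio_pos) auto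
      moreover have "a < 0 \<Longrightarrow> area_ratio (-a) > 0" using that by (intro area_ratio_pos) auto
      ultimately show ?thesis using 3 that z
        by (cases "a = 0"; cases "b = 0") (auto simp: area_ratio_minus)
    qed
  qed
  show ?thesis using less[of a b] less[of b a] assms by (cases a b rule: linorder_cases) auto
qed

lemma area_ratio_solution:
  assumes phi: "0 < \<phi>" "\<phi> < pi"
  obtains \<beta> where "\<phi> - pi < \<beta>" "\<beta> < \<phi>" "cos \<phi> + sin \<phi> * area_ratio \<beta> = 0"
proof -
  have sp: "sin \<phi> > 0" using phi by (rule sin_gt_zero)
  define f where "f \<beta> = cos \<phi> + sin \<phi> * area_ratio \<beta>" for \<beta>
  have f1: "f \<phi> = \<phi> / sin \<phi>"
    using sp by (simp add: f_def area_ratio_def divide_simps) (simp add: power2_eq_square algebra_simps)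
  have f2: "f (\<phi> - pi) = (\<phi> - pi) / sin \<phi>"
    using sp by (simp add: f_def area_ratio_def sin_diff cos_diff divide_simps) (simp add: power2_eq_square algebra_simps)
  have "isCont area_ratio x" if "x \<in> {\<phi> - pi..\<phi>}" for x
  proof (cases "x = 0")
    case True
    have "((\<lambda>\<beta>::real. (\<beta> - sin \<beta> * cos \<beta>) / (sin \<beta>)\<^sup>2) \<longlongrightarrow> 0) (at 0)" by real_asymp
    then show ?thesis using True by (simp add: isCont_def area_ratio_def[abs_def])
  next
    case False
    then have "sin x \<noteq> 0" using sin_div_pos[of x] that phi by force
    then show ?thesis using area_ratio_has_derivative DERIV_isCont by blast
  qed
  then have "continuous_on {\<phi> - pi..\<phi>} f"
    unfolding f_def by (intro continuous_intros continuous_at_imp_continuous_on) auto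
  then obtain b where b: "\<phi> - pi \<le> b" "b \<le> \<phi>" "f b = 0"
    using IVT'[of f "\<phi> - pi" 0 \<phi>] f1 f2 sp phi by (auto simp: divide_nonpos_pos)
  moreover have "b \<noteq> \<phi>" "b \<noteq> \<phi> - pi" using b f1 f2 sp phi by auto
  ultimately show ?thesis by (intro that[of b]) (auto simp: f_def)
qed

section \<open>Momenta and reflections on the cylinder\<close>

text \<open>The coefficients b, c of a covector, which are the planar velocity of the geodesic it generates.\<close>

definition heading :: "R3 \<Rightarrow> R3 \<Rightarrow> complex" where
  "heading = (\<lambda>(x, y, z) (lx, ly, lz). Complex (lx - lz * y / 2) (ly + lz * x / 2))"

lemma dual_norm_heading: "dual_norm q l = cmod (heading q l)"
  by (cases q; cases l) (simp add: dual_norm_eq heading_def cmod_def)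

lemma bounded_linear_planar_proj: "bounded_linear planar_proj"
proof -
  have "planar_proj = (\<lambda>q. of_real (fst q) + \<i> * of_real (fst (snd q)))"
    by (auto simp: planar_proj_def fun_eq_iff complex_eq_iff)
  moreover have "bounded_linear (\<lambda>q :: R3. of_real (fst q) + \<i> * of_real (fst (snd q)) :: complex)"
    by (intro bounded_linear_add bounded_linear_const_mult bounded_linear_of_real[THEN bounded_linear_compose]
        bounded_linear_fst_comp bounded_linear_snd_comp bounded_linear_fst bounded_linear_snd bounded_linear_ident)
  ultimately show ?thesis by simp
qed

lemma tendsto_heading:
  assumes "(q \<longlongrightarrow> q0) F" "(l \<longlongrightarrow> l0) F"
  shows "((\<lambda>t. heading (q t) (l t)) \<longlongrightarrow> heading q0 l0) F"
proof -
  have *: "heading = (\<lambda>q l. Complex (fst l - snd (snd l) * fst (snd q) / 2) (fst (snd l) + snd (snd l) * fst q / 2))"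
    by (auto simp: heading_def fun_eq_iff)
  show ?thesis
    unfolding * using assms by (auto intro!: tendsto_intros tendsto_Complex)
qed

text \<open>On the unit level the square root is differentiable with slope 1/2, so the differential
  is half that of \<open>b^2 + c^2\<close>. The position part is a force proportional to
  \<open>lz\<close> and perpendicular to the heading, which is what bends the planar
  projection.\<close>

lemma dual_norm_has_derivative:
  assumes h: "cmod (heading (x, y, z) (lx, ly, lz)) = 1" and "b = lx - lz * y / 2" "c = ly + lz * x / 2"
  shows "((\<lambda>(q, l). dual_norm q l) has_derivative
     (\<lambda>(u, w). (b, c, (c * x - b * y) / 2) \<bullet> w - (- (c * lz / 2), b * lz / 2, 0) \<bullet> u))
     (at ((x, y, z), (lx, ly, lz)))"
proof -
  let ?b = "\<lambda>r :: R3 \<times> R3. fst (snd r) - snd (snd (snd r)) * fst (snd (fst r)) / 2"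
  let ?c = "\<lambda>r :: R3 \<times> R3. fst (snd (snd r)) + snd (snd (snd r)) * fst (fst r) / 2"
  have *: "(\<lambda>(q, l). dual_norm q l) = (\<lambda>r. sqrt ((?b r)\<^sup>2 + (?c r)\<^sup>2))"
    by (auto simp: fun_eq_iff dual_norm_eq)
  have n: "b\<^sup>2 + c\<^sup>2 = 1"
    using h assms(2,3) by (simp add: heading_def cmod_def)
  have "((\<lambda>r. (?b r)\<^sup>2 + (?c r)\<^sup>2) has_derivative
     (\<lambda>r. 2 * ((b, c, (c * x - b * y) / 2) \<bullet> snd r - (- (c * lz / 2), b * lz / 2, 0) \<bullet> fst r)))
     (at ((x, y, z), (lx, ly, lz)))"
    unfolding assms(2,3)
    by (auto intro!: derivative_eq_intros simp: fun_eq_iff inner_prod_def) (simp add: field_simps)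
  from has_derivative_real_sqrt[OF _ this] n show ?thesis
    unfolding * by (auto intro: has_derivative_eq_rhs simp: fun_eq_iff assms(2,3))
qed

lemma hamilton_velocity:
  assumes "dual_norm (q t) (p t) = 1" and "hamilton_at (\<lambda>(q, l). dual_norm q l) q p t"
    and "planar_proj (q t) = c" "heading (q t) (p t) = h"
  shows "(q has_vector_derivative (Re h, Im h, Im (cnj c * h) / 2)) (at t)"
proof -
  obtain x y z where q: "q t = (x, y, z)" by (cases "q t")
  obtain lx ly lz where p: "p t = (lx, ly, lz)" by (cases "p t")
  from assms(2) obtain q' p' where d: "(q has_vector_derivative q') (at t)"
     "((\<lambda>(q, l). dual_norm q l) has_derivative (\<lambda>(u, w). q' \<bullet> w - p' \<bullet> u)) (at (q t, p t))"
    unfolding hamilton_at_def by blast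
  have "cmod (heading (x, y, z) (lx, ly, lz)) = 1" using assms(1) by (simp add: q p dual_norm_heading)
  \<comment> \<open>Evaluating the two differentials at vectors with zero position part removes the
    force and leaves the equation for the velocity alone.\<close>
  from fun_cong[OF has_derivative_unique[OF d(2)[unfolded q p] dual_norm_has_derivative[OF this refl refl]], of "(0, _)"]
  have "q' \<bullet> w = (Re h, Im h, (Im h * x - Re h * y) / 2) \<bullet> w" for w
    using assms(4) by (auto simp: q p heading_def)
  then have "q' = (Re h, Im h, (Im h * x - Re h * y) / 2)"
    using vector_eq_rdot[of q'] by blast
  then show ?thesis
    using d(1) assms(3) by (auto simp: q planar_proj_def algebra_simps)
qed

lemma hamilton_atI:
  assumes "cmod h = 1"
    and q: "(q has_vector_derivative (Re h, Im h, Im (cnj (Complex x y) * h) / 2)) (at t)"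
    and p: "(p has_vector_derivative (- (\<kappa> * Im h / 2), \<kappa> * Re h / 2, 0)) (at t)"
    and "q t = (x, y, z)" "p t = (Re h + \<kappa> * y / 2, Im h - \<kappa> * x / 2, \<kappa>)"
  shows "hamilton_at (\<lambda>(q, l). dual_norm q l) q p t"
proof -
  have "((\<lambda>(q, l). dual_norm q l) has_derivative
     (\<lambda>(u, w). (Re h, Im h, (Im h * x - Re h * y) / 2) \<bullet> w - (- (Im h * \<kappa> / 2), Re h * \<kappa> / 2, 0) \<bullet> u))
     (at ((x, y, z), (Re h + \<kappa> * y / 2, Im h - \<kappa> * x / 2, \<kappa>)))"
    using assms(1) by (intro dual_norm_has_derivative) (auto simp: heading_def)
  then show ?thesis
    unfolding hamilton_at_def using assms(4,5) q p
    by (intro exI conjI) (auto simp: algebra_simps)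
qed

section \<open>Boundary of the cylinder and its reflection law\<close>

lemma planar_proj_cylinder: "q \<in> std_cylinder \<longleftrightarrow> cmod (planar_proj q) \<le> 1"
  by (cases q) (simp add: std_cylinder_def planar_proj_def cmod_def)

lemma frontier_cylinder: "q \<in> frontier std_cylinder \<longleftrightarrow> cmod (planar_proj q) = 1"
proof -
  interpret planar_proj: bounded_linear planar_proj by (rule bounded_linear_planar_proj)
  have cont: "continuous_on UNIV (\<lambda>q. cmod (planar_proj q))"
    by (intro continuous_intros planar_proj.continuous_on)
  have cyl: "std_cylinder = {q. cmod (planar_proj q) \<le> 1}"
    by (auto simp: planar_proj_cylinder)
  have "closed std_cylinder"
    unfolding cyl by (intro closed_Collect_le cont continuous_intros)
  moreover have "interior std_cylinder = {q. cmod (planar_proj q) < 1}"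
  proof (rule interior_unique)
    show "open {q. cmod (planar_proj q) < 1}"
      by (intro open_Collect_less cont continuous_intros)
    fix T assume T: "T \<subseteq> std_cylinder" "open T"
    show "T \<subseteq> {q. cmod (planar_proj q) < 1}"
    proof
      fix q assume "q \<in> T"
      \<comment> \<open>An open set containing \<open>q\<close> also contains slightly enlarged
        copies of \<open>q\<close>; these would leave the cylinder if \<open>q\<close> projected to
        the unit circle.\<close>
      have "((\<lambda>r. r *\<^sub>R q) \<longlongrightarrow> 1 *\<^sub>R q) (at_right 1)"
        by (intro tendsto_intros)
      then have "eventually (\<lambda>r. r *\<^sub>R q \<in> T) (at_right 1)"
        using topological_tendstoD[of _ q] T \<open>q \<in> T\<close> by fastforce
      moreover have "eventually (\<lambda>r. 1 < r) (at_right (1 :: real))"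
        by (simp add: eventually_at_filter)
      ultimately have "eventually (\<lambda>r. 1 < r \<and> r *\<^sub>R q \<in> T) (at_right (1 :: real))"
        by eventually_elim simp
      then obtain r :: real where r: "1 < r" "r *\<^sub>R q \<in> T"
        using eventually_happens' trivial_limit_at_right_real by blast
      then have "r * cmod (planar_proj q) \<le> 1"
        using T(1) by (auto simp: planar_proj_cylinder planar_proj.scaleR)
      moreover have "1 * 1 < r * cmod (planar_proj q)" if "cmod (planar_proj q) \<ge> 1"
        using r that by (intro mult_less_le_imp_less) auto
      ultimately show "q \<in> {q. cmod (planar_proj q) < 1}" by force
    qed
  qed (auto simp: cyl)
  ultimately show ?thesis
    by (auto simp: frontier_def cyl)
qed

lemma annihilator_cylinder:
  assumes "cmod (planar_proj q) = 1"
  shows "(lx, ly, lz) \<in> annihilator (tangent_vectors (frontier std_cylinder) q) \<longleftrightarrow>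
     lz = 0 \<and> Im (cnj (planar_proj q) * Complex lx ly) = 0"
proof -
  obtain x y z where q: "q = (x, y, z)" by (cases q)
  have xy: "x\<^sup>2 + y\<^sup>2 = 1" using assms by (simp add: q planar_proj_def cmod_def)
  have fr: "(x, y, z) \<in> frontier std_cylinder \<longleftrightarrow> x\<^sup>2 + y\<^sup>2 = 1" for x y z
    by (simp add: frontier_cylinder planar_proj_def cmod_def)
  have tan: "(u, v, w) \<in> tangent_vectors (frontier std_cylinder) q \<longleftrightarrow> x * u + y * v = 0" for u v w
  proof
    assume "(u, v, w) \<in> tangent_vectors (frontier std_cylinder) q"
    then obtain c where c: "\<And>s. c s \<in> frontier std_cylinder" "c (0 :: real) = q"
        "(c has_vector_derivative (u, v, w)) (at 0)"
      unfolding tangent_vectors_def by blast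
    have d1: "((\<lambda>s. fst (c s)) has_real_derivative u) (at 0)"
      using bounded_linear.has_vector_derivative[OF bounded_linear_fst c(3)]
      by (simp add: has_real_derivative_iff_has_vector_derivative)
    have d2: "((\<lambda>s. fst (snd (c s))) has_real_derivative v) (at 0)"
      using bounded_linear.has_vector_derivative[OF bounded_linear_fst bounded_linear.has_vector_derivative[OF bounded_linear_snd c(3)]]
      by (simp add: has_real_derivative_iff_has_vector_derivative)
    have "(fst (c s))\<^sup>2 + (fst (snd (c s)))\<^sup>2 = 1" for s
      using c(1)[of s] fr[of "fst (c s)" "fst (snd (c s))" "snd (snd (c s))"] by simp
    then have "((\<lambda>s. (fst (c s))\<^sup>2 + (fst (snd (c s)))\<^sup>2) has_real_derivative 0) (at 0)"
      by simp
    moreover have "((\<lambda>s. (fst (c s))\<^sup>2 + (fst (snd (c s)))\<^sup>2) has_real_derivative 2 * x * u + 2 * y * v) (at 0)"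
      using DERIV_add[OF DERIV_power[OF d1, of 2] DERIV_power[OF d2, of 2]]
      by (simp add: c(2) q mult_ac)
    ultimately have "2 * x * u + 2 * y * v = 0" using DERIV_unique by blast
    then show "x * u + y * v = 0" by simp
  next
    assume uv: "x * u + y * v = 0"
    \<comment> \<open>\<open>r\<close> is the angular velocity of the given vector about the axis.
      The helix with this angular velocity and vertical speed \<open>w\<close> stays on the frontier
      for all parameters, as \<open>tangent_vectors\<close> demands.\<close>
    define r where "r = x * v - y * u"
    define c where "c s = (x * cos (r * s) - y * sin (r * s), x * sin (r * s) + y * cos (r * s), z + w * s)" for s
    have u: "- (y * r) = u" and v: "x * r = v"
    proof -
      have "u = (x\<^sup>2 + y\<^sup>2) * u" "v = (x\<^sup>2 + y\<^sup>2) * v" by (simp_all add: xy)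
      then show "- (y * r) = u" "x * r = v"
        using uv unfolding r_def by algebra+
    qed
    have "(c has_vector_derivative (- (y * r), x * r, w)) (at 0)"
    proof -
      have "((\<lambda>s. x * cos (r * s) - y * sin (r * s)) has_real_derivative - (y * r)) (at 0)"
        "((\<lambda>s. x * sin (r * s) + y * cos (r * s)) has_real_derivative x * r) (at 0)"
        "((\<lambda>s. z + w * s) has_real_derivative w) (at 0)"
        by (auto intro!: derivative_eq_intros)
      then show ?thesis
        unfolding c_def[abs_def] has_real_derivative_iff_has_vector_derivative
        by (intro has_vector_derivative_Pair)
    qed
    moreover have "c s \<in> frontier std_cylinder" for s
    proof -
      have "(x * cos (r * s) - y * sin (r * s))\<^sup>2 + (x * sin (r * s) + y * cos (r * s))\<^sup>2
        = (x\<^sup>2 + y\<^sup>2) * ((cos (r * s))\<^sup>2 + (sin (r * s))\<^sup>2)" by algebra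
      then show ?thesis unfolding c_def fr by (simp add: xy)
    qed
    ultimately show "(u, v, w) \<in> tangent_vectors (frontier std_cylinder) q"
      unfolding tangent_vectors_def u v by (auto intro!: exI[of _ c] simp: c_def q)
  qed
  have "(lx, ly, lz) \<in> annihilator (tangent_vectors (frontier std_cylinder) q) \<longleftrightarrow> lz = 0 \<and> x * ly - y * lx = 0"
  proof
    assume *: "(lx, ly, lz) \<in> annihilator (tangent_vectors (frontier std_cylinder) q)"
    have "(0, 0, 1) \<in> tangent_vectors (frontier std_cylinder) q"
      "(- y, x, 0) \<in> tangent_vectors (frontier std_cylinder) q" by (simp_all add: tan)
    from *[unfolded annihilator_def, simplified, rule_format, OF this(1)]
      *[unfolded annihilator_def, simplified, rule_format, OF this(2)]
    show "lz = 0 \<and> x * ly - y * lx = 0" by (simp add: mult.commute)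
  next
    assume *: "lz = 0 \<and> x * ly - y * lx = 0"
    have "lx * u + ly * v = 0" if "x * u + y * v = 0" for u v
    proof -
      have "lx * u + ly * v = (x\<^sup>2 + y\<^sup>2) * (lx * u + ly * v)" by (simp add: xy)
      \<comment> \<open>Expansion of both planar vectors in the orthonormal frame of the radial and
        the tangential direction.\<close>
      also have "\<dots> = (x * lx + y * ly) * (x * u + y * v) + (x * ly - y * lx) * (x * v - y * u)"
        by algebra
      finally show ?thesis using * that by simp
    qed
    then show "(lx, ly, lz) \<in> annihilator (tangent_vectors (frontier std_cylinder) q)"
      using * by (auto simp: annihilator_def tan)
  qed
  then show ?thesis by (simp add: q planar_proj_def mult.commute)
qed

text \<open>Translates the reflection law from covectors to planar velocities. The heading differs
  from the first two coefficients by a term depending only on \<open>q\<close> and the third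
  coefficient, so it cancels once the third coefficients agree.\<close>

lemma annihilator_cylinder_heading:
  assumes "cmod (planar_proj q) = 1"
  shows "l - l' \<in> annihilator (tangent_vectors (frontier std_cylinder) q) \<longleftrightarrow>
     snd (snd l) = snd (snd l') \<and>
     Im (cnj (planar_proj q) * heading q l) = Im (cnj (planar_proj q) * heading q l')"
proof -
  obtain lx ly lz lx' ly' lz' x y z where "l = (lx, ly, lz)" "l' = (lx', ly', lz')" "q = (x, y, z)"
    by (cases l, cases l', cases q)
  then show ?thesis
    using annihilator_cylinder[OF assms, of "lx - lx'" "ly - ly'" "lz - lz'"]
    by (auto simp: heading_def planar_proj_def algebra_simps)
qed

text \<open>Turns a jump of the momentum into a jump of the planar direction, since a reflection
  preserves the third coefficient.\<close>

lemma heading_inj: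
  "snd (snd l) = snd (snd l') \<Longrightarrow> heading q l = heading q l' \<Longrightarrow> l = l'"
  by (cases q; cases l; cases l') (simp add: heading_def)

section \<open>Uniqueness\<close>

lemma cnj_unit_cancel:
  assumes "cmod P = 1"
  shows "cnj P * (P * z) = z" "cnj (P * y) * (P * z) = cnj y * z"
proof -
  have *: "cnj P * P = 1" using complex_norm_square[of P] assms by (simp add: mult.commute)
  then show "cnj P * (P * z) = z" unfolding mult.assoc[symmetric] by simp
  have "cnj (P * y) * (P * z) = (cnj P * P) * (cnj y * z)" by simp
  then show "cnj (P * y) * (P * z) = cnj y * z" using * by simp
qed

text \<open>An outward velocity would push the squared modulus above 1 at once. The inequality is
  weak because gliding along the circle also respects the disc.\<close>

lemma disc_start_inward:
  assumes "(c has_vector_derivative h) (at s within {s..u})" "s < u" "cmod (c s) = 1"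
    and disc: "\<And>t. t \<in> {s..u} \<Longrightarrow> cmod (c t) \<le> 1"
  shows "Re (cnj (c s) * h) \<le> 0"
proof (rule ccontr)
  assume "\<not> Re (cnj (c s) * h) \<le> 0"
  then have "2 * Re (cnj (c s) * h) > 0" by simp
  from has_real_derivative_pos_inc_right[OF cmod_sq_has_derivative[OF assms(1)] this]
  obtain d where d: "d > 0" "\<And>k. k > 0 \<Longrightarrow> s + k \<in> {s..u} \<Longrightarrow> k < d \<Longrightarrow> (cmod (c s))\<^sup>2 < (cmod (c (s + k)))\<^sup>2"
    by blast
  define k where "k = min (d / 2) (u - s)"
  have k: "k > 0" "k < d" "s + k \<in> {s..u}" using d(1) assms(2) by (auto simp: k_def)
  then have "1 < (cmod (c (s + k)))\<^sup>2" using d(2)[of k] assms(3) by simp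
  moreover have "(cmod (c (s + k)))\<^sup>2 \<le> 1" using disc[OF k(3)] by (simp add: power_le_one_iff)
  ultimately show False by simp
qed

lemma disc_end_outward:
  assumes "(c has_vector_derivative h) (at u within {s..u})" "s < u" "cmod (c u) = 1"
    and disc: "\<And>t. t \<in> {s..u} \<Longrightarrow> cmod (c t) \<le> 1"
  shows "Re (cnj (c u) * h) \<ge> 0"
proof (rule ccontr)
  assume "\<not> Re (cnj (c u) * h) \<ge> 0"
  then have "2 * Re (cnj (c u) * h) < 0" by simp
  from has_real_derivative_neg_dec_left[OF cmod_sq_has_derivative[OF assms(1)] this]
  obtain d where d: "d > 0" "\<And>k. k > 0 \<Longrightarrow> u - k \<in> {s..u} \<Longrightarrow> k < d \<Longrightarrow> (cmod (c u))\<^sup>2 < (cmod (c (u - k)))\<^sup>2"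
    by blast
  define k where "k = min (d / 2) (u - s)"
  have k: "k > 0" "k < d" "u - k \<in> {s..u}" using d(1) assms(2) by (auto simp: k_def)
  then have "1 < (cmod (c (u - k)))\<^sup>2" using d(2)[of k] assms(3) by simp
  moreover have "(cmod (c (u - k)))\<^sup>2 \<le> 1" using disc[OF k(3)] by (simp add: power_le_one_iff)
  ultimately show False by simp
qed

text \<open>If the outgoing direction were tangential, the incoming one, having the same length and
  the same tangential component, would have no radial part either, and the two would
  coincide.\<close>

lemma unit_reflection_inward:
  assumes "cmod P = 1" "cmod h = 1" "cmod h' = 1" "h \<noteq> h'"
    and "Im (cnj P * h) = Im (cnj P * h')" "Re (cnj P * h) \<ge> 0" "Re (cnj P * h') \<le> 0"
  shows "Re (cnj P * h') < 0"
proof (rule ccontr)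
  assume "\<not> ?thesis"
  then have r: "Re (cnj P * h') = 0" using assms by simp
  have "(cmod (cnj P * h))\<^sup>2 = (cmod (cnj P * h'))\<^sup>2" using assms by (simp add: norm_mult)
  then have "Re (cnj P * h) = 0" using r assms(5) unfolding cmod_power2 by simp
  then have "cnj P * h = cnj P * h'" using r assms(5) by (simp add: complex_eq_iff)
  then show False using assms by auto
qed

text \<open>The third component does not involve \<open>P\<close>: for unit \<open>P\<close> the
  multiplication is a rotation about the origin, under which the area swept from the origin is
  invariant.\<close>

definition arc_lift :: "real \<Rightarrow> complex \<Rightarrow> complex \<Rightarrow> real \<Rightarrow> R3" where
  "arc_lift \<kappa> w P s = (Re (P * arc_point \<kappa> w s), Im (P * arc_point \<kappa> w s), arc_height \<kappa> w s)"

text \<open>The floor assigns each reflection time to the arc that starts there. Every piece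
  restarts at height 0, so the pieces fit together only if an arc gains no height.\<close>

definition polygon_orbit :: "real \<Rightarrow> real \<Rightarrow> complex \<Rightarrow> real \<Rightarrow> R3" where
  "polygon_orbit \<phi> \<beta> v t =
     (let L = arc_length \<phi> \<beta>; k = \<lfloor>t / L\<rfloor>
      in arc_lift (sin \<beta> / sin \<phi>) (launch \<phi> \<beta>) (v * cis (2 * \<phi> * of_int k)) (t - of_int k * L))"

section \<open>Analysis of a given closed trajectory\<close>

lemma int_stepwise_constant:
  fixes f :: "int \<Rightarrow> 'a"
  assumes "\<And>k. f (k + 1) = f k"
  shows "f k = f 0"
proof (induction k rule: int_induct[where k = 0])
  case (step1 i) then show ?case using assms[of i] by simp
next
  case (step2 i) then show ?case using assms[of "i - 1"] by simp
qed simp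

locale ngon_billiard =
  fixes \<phi> :: real and n :: nat and \<tau> :: "int \<Rightarrow> real" and \<gamma> p :: "real \<Rightarrow> R3" and \<theta> \<kappa> :: "int \<Rightarrow> real"
  assumes phi: "0 < \<phi>" "\<phi> < pi" and n: "n > 0" and mono: "strict_mono \<tau>"
    and cont: "continuous_on UNIV \<gamma>" and cyl: "range \<gamma> \<subseteq> std_cylinder"
    and unit: "\<And>t. t \<notin> range \<tau> \<Longrightarrow> dual_norm (\<gamma> t) (p t) = 1"
    and ham: "\<And>t. t \<notin> range \<tau> \<Longrightarrow> hamilton_at (\<lambda>(q, l). dual_norm q l) \<gamma> p t"
    and bdry: "\<And>k. \<gamma> (\<tau> k) \<in> frontier std_cylinder"
    and refl: "\<And>k. \<exists>l_in l_out.
              (p \<longlongrightarrow> l_in) (at_left (\<tau> k)) \<and> (p \<longlongrightarrow> l_out) (at_right (\<tau> k)) \<and>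
              l_in \<noteq> l_out \<and> l_in - l_out \<in> annihilator (tangent_vectors (frontier std_cylinder) (\<gamma> (\<tau> k)))"
    and seg: "\<And>k t. t \<in> {\<tau> k..\<tau> (k + 1)} \<Longrightarrow>
       ((planar_proj \<circ> \<gamma>) has_vector_derivative cis (\<theta> k + \<kappa> k * t)) (at t within {\<tau> k..\<tau> (k + 1)})"
    and rot: "\<And>k. planar_proj (\<gamma> (\<tau> (k + 1))) = cis (2 * \<phi>) * planar_proj (\<gamma> (\<tau> k))"
    and per: "\<And>k. snd (snd (\<gamma> (\<tau> (k + int n)))) = snd (snd (\<gamma> (\<tau> k)))"
begin

definition c :: "real \<Rightarrow> complex" where "c t = planar_proj (\<gamma> t)"

definition z :: "real \<Rightarrow> real" where "z t = snd (snd (\<gamma> t))"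

lemma gamma_eq: "\<gamma> t = (Re (c t), Im (c t), z t)"
  by (cases "\<gamma> t") (simp add: c_def z_def planar_proj_def)

lemma tau_less: "\<tau> k < \<tau> (k + 1)"
  using mono by (simp add: strict_mono_def)

lemma c_disc: "cmod (c t) \<le> 1"
  using cyl planar_proj_cylinder[of "\<gamma> t"] by (auto simp: c_def)

lemma c_vertex: "cmod (c (\<tau> k)) = 1"
  using bdry frontier_cylinder by (simp add: c_def)

lemma c_deriv:
  "t \<in> {\<tau> k..\<tau> (k + 1)} \<Longrightarrow> (c has_vector_derivative cis (\<theta> k + \<kappa> k * t)) (at t within {\<tau> k..\<tau> (k + 1)})"
  using seg[of t k] by (simp add: c_def[abs_def] o_def)

text \<open>Inside a segment the planar projection has two descriptions of its derivative, one from
  Hamilton's equations and one from the constant curvature; uniqueness of derivatives identifies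
  them.\<close>

lemma
  assumes t: "\<tau> k < t" "t < \<tau> (k + 1)"
  shows heading_eq: "heading (\<gamma> t) (p t) = cis (\<theta> k + \<kappa> k * t)"
    and z_deriv: "(z has_real_derivative Im (cnj (c t) * cis (\<theta> k + \<kappa> k * t)) / 2) (at t)"
proof -
  define h where "h = heading (\<gamma> t) (p t)"
  have "t \<noteq> \<tau> j" for j
    using t strict_mono_less[OF mono, of k j] strict_mono_less[OF mono, of j "k + 1"] by fastforce
  then have "t \<notin> range \<tau>" by blast
  from hamilton_velocity[OF unit[OF this] ham[OF this]]
  have g: "(\<gamma> has_vector_derivative (Re h, Im h, Im (cnj (c t) * h) / 2)) (at t)"
    by (simp add: c_def h_def)
  from bounded_linear.has_vector_derivative[OF bounded_linear_planar_proj g]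
  have "(c has_vector_derivative h) (at t)"
    by (simp add: c_def[abs_def] planar_proj_def)
  moreover have "(c has_vector_derivative cis (\<theta> k + \<kappa> k * t)) (at t)"
    using c_deriv[of t k] t by (simp add: at_within_Icc_at)
  ultimately have h: "h = cis (\<theta> k + \<kappa> k * t)"
    by (rule vector_derivative_unique_at)
  then show "heading (\<gamma> t) (p t) = cis (\<theta> k + \<kappa> k * t)" by (simp add: h_def)
  show "(z has_real_derivative Im (cnj (c t) * cis (\<theta> k + \<kappa> k * t)) / 2) (at t)"
    using bounded_linear.has_vector_derivative[OF bounded_linear_snd bounded_linear.has_vector_derivative[OF bounded_linear_snd g]]
    by (simp add: z_def[abs_def] has_real_derivative_iff_has_vector_derivative flip: h)
qed

text \<open>The momentum is not known explicitly, only its heading on the open arcs. Its one-sided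
  limits are therefore compared through the heading, computed once from the limits of
  \<open>p\<close> and once from the direction of the arc.\<close>

lemma
  defines "h k \<equiv> cis (\<theta> k + \<kappa> k * \<tau> k)" and "h' k \<equiv> cis (\<theta> k + \<kappa> k * \<tau> (k + 1))"
  shows elastic: "Im (cnj (c (\<tau> (k + 1))) * h' k) = Im (cnj (c (\<tau> (k + 1))) * h (k + 1))"
    and headings_differ: "h' k \<noteq> h (k + 1)"
proof -
  let ?t = "\<tau> (k + 1)"
  obtain l l' where l: "(p \<longlongrightarrow> l) (at_left ?t)" "(p \<longlongrightarrow> l') (at_right ?t)" "l \<noteq> l'"
     "l - l' \<in> annihilator (tangent_vectors (frontier std_cylinder) (\<gamma> ?t))"
    using refl by blast
  have g: "(\<gamma> \<longlongrightarrow> \<gamma> ?t) (at ?t within S)" for S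
    using cont by (simp add: continuous_on_eq_continuous_at isCont_def tendsto_within_subset[of _ _ _ UNIV])
  have "((\<lambda>t. heading (\<gamma> t) (p t)) \<longlongrightarrow> heading (\<gamma> ?t) l) (at_left ?t)"
    by (intro tendsto_heading g l)
  moreover have "((\<lambda>t. heading (\<gamma> t) (p t)) \<longlongrightarrow> h' k) (at_left ?t)"
  proof (rule Lim_transform_eventually)
    show "((\<lambda>t. cis (\<theta> k + \<kappa> k * t)) \<longlongrightarrow> h' k) (at_left ?t)"
      unfolding h'_def by (intro tendsto_intros)
    show "\<forall>\<^sub>F t in at_left ?t. cis (\<theta> k + \<kappa> k * t) = heading (\<gamma> t) (p t)"
      using eventually_at_left_real[OF tau_less[of k]]
      by eventually_elim (simp add: heading_eq[of k])
  qed
  ultimately have hl: "heading (\<gamma> ?t) l = h' k"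
    by (rule tendsto_unique[OF trivial_limit_at_left_real])
  have "((\<lambda>t. heading (\<gamma> t) (p t)) \<longlongrightarrow> heading (\<gamma> ?t) l') (at_right ?t)"
    by (intro tendsto_heading g l)
  moreover have "((\<lambda>t. heading (\<gamma> t) (p t)) \<longlongrightarrow> h (k + 1)) (at_right ?t)"
  proof (rule Lim_transform_eventually)
    show "((\<lambda>t. cis (\<theta> (k + 1) + \<kappa> (k + 1) * t)) \<longlongrightarrow> h (k + 1)) (at_right ?t)"
      unfolding h_def by (intro tendsto_intros)
    show "\<forall>\<^sub>F t in at_right ?t. cis (\<theta> (k + 1) + \<kappa> (k + 1) * t) = heading (\<gamma> t) (p t)"
      using eventually_at_right_real[OF tau_less[of "k + 1"]]
      by eventually_elim (simp add: heading_eq[of "k + 1"])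
  qed
  ultimately have hl': "heading (\<gamma> ?t) l' = h (k + 1)"
    by (rule tendsto_unique[OF trivial_limit_at_right_real])
  have "cmod (planar_proj (\<gamma> ?t)) = 1" using c_vertex by (simp add: c_def)
  from annihilator_cylinder_heading[OF this] l(4)
  have "snd (snd l) = snd (snd l')" and *: "Im (cnj (c ?t) * h' k) = Im (cnj (c ?t) * h (k + 1))"
    by (auto simp: c_def hl hl')
  then show "Im (cnj (c ?t) * h' k) = Im (cnj (c ?t) * h (k + 1))" by simp
  show "h' k \<noteq> h (k + 1)"
    using heading_inj[of l l' "\<gamma> ?t"] \<open>snd (snd l) = snd (snd l')\<close> l(3) hl hl' by auto
qed

text \<open>Every vertex is also the end of the preceding arc, which supplies the incoming
  direction.\<close>

lemma start_inward: "Re (cnj (c (\<tau> k)) * cis (\<theta> k + \<kappa> k * \<tau> k)) < 0"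
proof -
  show ?thesis
  proof (rule unit_reflection_inward)
    show "cmod (c (\<tau> k)) = 1" by (rule c_vertex)
    show "cis (\<theta> (k - 1) + \<kappa> (k - 1) * \<tau> k) \<noteq> cis (\<theta> k + \<kappa> k * \<tau> k)"
      using headings_differ[of "k - 1"] by simp
    show "Im (cnj (c (\<tau> k)) * cis (\<theta> (k - 1) + \<kappa> (k - 1) * \<tau> k)) = Im (cnj (c (\<tau> k)) * cis (\<theta> k + \<kappa> k * \<tau> k))"
      using elastic[of "k - 1"] by simp
    show "0 \<le> Re (cnj (c (\<tau> k)) * cis (\<theta> (k - 1) + \<kappa> (k - 1) * \<tau> k))"
      using c_deriv[of "\<tau> k" "k - 1"] tau_less[of "k - 1"]
      by (intro disc_end_outward[where s = "\<tau> (k - 1)"]) (auto simp: c_vertex c_disc)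
    show "Re (cnj (c (\<tau> k)) * cis (\<theta> k + \<kappa> k * \<tau> k)) \<le> 0"
      using c_deriv[of "\<tau> k" "k"] tau_less[of "k"]
      by (intro disc_start_inward[where u = "\<tau> (k + 1)"]) (auto simp: c_vertex c_disc)
  qed simp_all
qed

text \<open>Collected into one formula of the form \<forall> \<exists> so that choice can pick
  \<beta> for all arcs at once.\<close>

lemma segments:
  "\<forall>k. \<exists>\<beta>. \<phi> - pi < \<beta> \<and> \<beta> < \<phi> \<and> \<tau> (k + 1) - \<tau> k = arc_length \<phi> \<beta> \<and> \<kappa> k = sin \<beta> / sin \<phi> \<and>
       cis (\<theta> k + \<kappa> k * \<tau> k) = c (\<tau> k) * launch \<phi> \<beta> \<and>
       (\<forall>t \<in> {\<tau> k..\<tau> (k + 1)}. c t = c (\<tau> k) * arc_point (\<kappa> k) (launch \<phi> \<beta>) (t - \<tau> k))"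
proof
  fix k
  define w where "w = cnj (c (\<tau> k)) * cis (\<theta> k + \<kappa> k * \<tau> k)"
  have arc: "c t = c (\<tau> k) * arc_point (\<kappa> k) w (t - \<tau> k)" if "t \<in> {\<tau> k..\<tau> (k + 1)}" for t
    unfolding w_def
    by (rule constant_curvature_eq_arc[of "\<tau> k" "\<tau> (k + 1)" c "\<theta> k" "\<kappa> k", OF c_deriv c_vertex that])
  have nz: "c (\<tau> k) \<noteq> 0" using c_vertex[of k] by auto
  have unit: "cmod w = 1" by (simp add: w_def norm_mult c_vertex)
  have inw: "Re w < 0" unfolding w_def by (rule start_inward)
  have disc: "cmod (arc_point (\<kappa> k) w r) \<le> 1" if "0 \<le> r" "r \<le> \<tau> (k + 1) - \<tau> k" for r
    using arc[of "\<tau> k + r"] c_disc[of "\<tau> k + r"] c_vertex[of k] that by (simp add: norm_mult)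
  have fin: "arc_point (\<kappa> k) w (\<tau> (k + 1) - \<tau> k) = cis (2 * \<phi>)"
    using arc[of "\<tau> (k + 1)"] tau_less[of k] rot[of k] nz by (simp add: c_def)
  have len: "0 < \<tau> (k + 1) - \<tau> k" using tau_less[of k] by simp
  obtain \<beta> where b: "\<phi> - pi < \<beta>" "\<beta> < \<phi>" "\<tau> (k + 1) - \<tau> k = arc_length \<phi> \<beta>" "\<kappa> k = sin \<beta> / sin \<phi>"
      and w: "w = launch \<phi> \<beta>"
    by (rule arc_launch[OF phi len unit inw disc fin])
  have "c (\<tau> k) * w = (cnj (c (\<tau> k)) * c (\<tau> k)) * cis (\<theta> k + \<kappa> k * \<tau> k)"
    unfolding w_def by simp
  also have "cnj (c (\<tau> k)) * c (\<tau> k) = 1"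
    using cnj_unit_cancel(1)[OF c_vertex, of k 1] by simp
  finally have start: "cis (\<theta> k + \<kappa> k * \<tau> k) = c (\<tau> k) * launch \<phi> \<beta>"
    unfolding w mult_1_left by (rule sym)
  show "\<exists>\<beta>. \<phi> - pi < \<beta> \<and> \<beta> < \<phi> \<and> \<tau> (k + 1) - \<tau> k = arc_length \<phi> \<beta> \<and> \<kappa> k = sin \<beta> / sin \<phi> \<and>
       cis (\<theta> k + \<kappa> k * \<tau> k) = c (\<tau> k) * launch \<phi> \<beta> \<and>
       (\<forall>t \<in> {\<tau> k..\<tau> (k + 1)}. c t = c (\<tau> k) * arc_point (\<kappa> k) (launch \<phi> \<beta>) (t - \<tau> k))"
    by (intro exI[of _ \<beta>] conjI ballI b start arc[unfolded w])
qed

lemma uniform_segments: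
  obtains \<beta> where "\<phi> - pi < \<beta>" "\<beta> < \<phi>"
    "\<And>k. \<tau> (k + 1) - \<tau> k = arc_length \<phi> \<beta>" "\<And>k. \<kappa> k = sin \<beta> / sin \<phi>"
    "\<And>k. cis (\<theta> k + \<kappa> k * \<tau> k) = c (\<tau> k) * launch \<phi> \<beta>"
    "\<And>k t. t \<in> {\<tau> k..\<tau> (k + 1)} \<Longrightarrow> c t = c (\<tau> k) * arc_point (\<kappa> k) (launch \<phi> \<beta>) (t - \<tau> k)"
proof -
  obtain B where B': "\<forall>k. \<phi> - pi < B k \<and> B k < \<phi> \<and>
      \<tau> (k + 1) - \<tau> k = arc_length \<phi> (B k) \<and> \<kappa> k = sin (B k) / sin \<phi> \<and>
      cis (\<theta> k + \<kappa> k * \<tau> k) = c (\<tau> k) * launch \<phi> (B k) \<and>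
      (\<forall>t \<in> {\<tau> k..\<tau> (k + 1)}. c t = c (\<tau> k) * arc_point (\<kappa> k) (launch \<phi> (B k)) (t - \<tau> k))"
    by (rule exE[OF choice[OF segments]])
  have B: "\<phi> - pi < B k" "B k < \<phi>" "\<tau> (k + 1) - \<tau> k = arc_length \<phi> (B k)"
    "\<kappa> k = sin (B k) / sin \<phi>" "cis (\<theta> k + \<kappa> k * \<tau> k) = c (\<tau> k) * launch \<phi> (B k)"
    "\<And>t. t \<in> {\<tau> k..\<tau> (k + 1)} \<Longrightarrow> c t = c (\<tau> k) * arc_point (\<kappa> k) (launch \<phi> (B k)) (t - \<tau> k)" for k
    by (rule B'[THEN spec, THEN conjunct1] B'[THEN spec, THEN conjunct2, THEN conjunct1]
      B'[THEN spec, THEN conjunct2, THEN conjunct2, THEN conjunct1]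
      B'[THEN spec, THEN conjunct2, THEN conjunct2, THEN conjunct2, THEN conjunct1]
      B'[THEN spec, THEN conjunct2, THEN conjunct2, THEN conjunct2, THEN conjunct2, THEN conjunct1]
      B'[THEN spec, THEN conjunct2, THEN conjunct2, THEN conjunct2, THEN conjunct2, THEN conjunct2, THEN bspec] | assumption)+
  have "B (k + 1) = B k" for k
  proof -
    interpret chord \<phi> "B k" using phi B by unfold_locales
    have cis_Im: "Im (cis (x + pi / 2)) = cos x" for x by (simp add: sin_add)
    have "\<kappa> k * (\<tau> (k + 1) - \<tau> k) = 2 * B k"
      unfolding B(3) unfolding B(4) by (rule curvature_length)
    then have "\<theta> k + \<kappa> k * \<tau> (k + 1) = (\<theta> k + \<kappa> k * \<tau> k) + 2 * B k"
      by (simp add: right_diff_distrib)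
    then have "cis (\<theta> k + \<kappa> k * \<tau> (k + 1)) = c (\<tau> k) * launch \<phi> (B k) * cis (2 * B k)"
      unfolding B(5)[symmetric] cis_mult by (rule arg_cong)
    \<comment> \<open>The arrival angle is the launch angle plus \<open>2 * B k\<close>. It is split
      so that the rotation to the next vertex can be absorbed, leaving the direction relative to
      that vertex.\<close>
    also have "\<dots> = c (\<tau> k) * cis (2 * \<phi> + (B k - \<phi> + pi / 2))"
      unfolding mult.assoc cis_mult by (rule arg_cong[where f = "\<lambda>x. c (\<tau> k) * cis x"]) simp
    also have "\<dots> = c (\<tau> (k + 1)) * cis (B k - \<phi> + pi / 2)"
      unfolding c_def rot cis_mult[symmetric] by simp
    finally have "Im (cnj (c (\<tau> (k + 1))) * cis (\<theta> k + \<kappa> k * \<tau> (k + 1))) = cos (B k - \<phi>)"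
      by (simp only: cnj_unit_cancel[OF c_vertex] cis_Im)
    then have "cos (\<phi> - B k) = Im (cnj (c (\<tau> (k + 1))) * cis (\<theta> k + \<kappa> k * \<tau> (k + 1)))"
      using cos_minus[of "\<phi> - B k"] by simp
    also have "\<dots> = Im (cnj (c (\<tau> (k + 1))) * cis (\<theta> (k + 1) + \<kappa> (k + 1) * \<tau> (k + 1)))"
      by (rule elastic)
    also have "\<dots> = Im (cis (\<phi> - B (k + 1) + pi / 2))"
      unfolding B(5) cnj_unit_cancel[OF c_vertex] by (rule arg_cong[where f = "\<lambda>x. Im (cis x)"]) simp
    also have "\<dots> = cos (\<phi> - B (k + 1))" by (rule cis_Im)
    finally have eq: "cos (\<phi> - B k) = cos (\<phi> - B (k + 1))" .
    \<comment> \<open>The admissible range of half turning angles keeps these angles in [0, pi],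
      where the cosine determines them.\<close>
    have range: "0 \<le> \<phi> - B j" "\<phi> - B j \<le> pi" for j
      using B(1,2)[of j] by linarith+
    have "\<phi> - B k = \<phi> - B (k + 1)"
      by (rule cos_inj_pi[OF range range eq])
    then show ?thesis by simp
  qed
  then have eq: "B k = B 0" for k by (rule int_stepwise_constant)
  show ?thesis
  proof (rule that[of "B 0"])
    fix k
    show "\<tau> (k + 1) - \<tau> k = arc_length \<phi> (B 0)" "\<kappa> k = sin (B 0) / sin \<phi>"
      "cis (\<theta> k + \<kappa> k * \<tau> k) = c (\<tau> k) * launch \<phi> (B 0)"
      using B(3-5)[of k] by (simp_all only: eq[of k])
    show "c t = c (\<tau> k) * arc_point (\<kappa> k) (launch \<phi> (B 0)) (t - \<tau> k)" if "t \<in> {\<tau> k..\<tau> (k + 1)}" for t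
      using B(6)[OF that] by (simp only: eq[of k])
  qed (use B(1,2) in auto)
qed

text \<open>The derivative of \<open>z\<close> is available only strictly between reflections, so
  continuity of the trajectory has to carry the identity to the ends of the segment.\<close>

lemma height_on_segment:
  assumes b: "cis (\<theta> k + \<kappa> k * \<tau> k) = c (\<tau> k) * w" and w: "cmod w = 1"
    and arc: "\<And>t. t \<in> {\<tau> k..\<tau> (k + 1)} \<Longrightarrow> c t = c (\<tau> k) * arc_point (\<kappa> k) w (t - \<tau> k)"
    and t: "t \<in> {\<tau> k..\<tau> (k + 1)}"
  shows "z t = z (\<tau> k) + arc_height (\<kappa> k) w (t - \<tau> k)"
proof -
  let ?f = "\<lambda>t. z t - arc_height (\<kappa> k) w (t - \<tau> k)"
  have "?f t = ?f (\<tau> k)"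
  proof (rule DERIV_isconst2[OF tau_less[of k]])
    have "continuous_on {\<tau> k..\<tau> (k + 1)} z"
      unfolding z_def[abs_def] by (intro continuous_intros continuous_on_subset[OF cont]) auto
    moreover have "continuous_on {\<tau> k..\<tau> (k + 1)} (\<lambda>t. arc_height (\<kappa> k) w (t - \<tau> k))"
      by (rule DERIV_continuous_on[OF arc_height_shift_has_derivative[OF w]])
    ultimately show "continuous_on {\<tau> k..\<tau> (k + 1)} ?f" by (intro continuous_intros)
    fix t assume t: "\<tau> k < t" "t < \<tau> (k + 1)"
    have "cis (\<theta> k + \<kappa> k * t) = cis (\<theta> k + \<kappa> k * \<tau> k) * cis (\<kappa> k * (t - \<tau> k))"
      by (simp add: cis_mult algebra_simps)
    then have h: "cis (\<theta> k + \<kappa> k * t) = c (\<tau> k) * (w * cis (\<kappa> k * (t - \<tau> k)))"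
      using b by simp
    have ct: "c t = c (\<tau> k) * arc_point (\<kappa> k) w (t - \<tau> k)" using t by (intro arc) auto
    from DERIV_diff[OF z_deriv[OF t] arc_height_shift_has_derivative[OF w, of "\<kappa> k" "\<tau> k" t UNIV]]
    show "(?f has_real_derivative 0) (at t)"
      unfolding h ct cnj_unit_cancel[OF c_vertex] by simp
  qed (use t in auto)
  then show ?thesis by simp
qed

lemma eq_polygon_orbit:
  assumes b: "\<phi> - pi < b" "b < \<phi>" "cos \<phi> + sin \<phi> * area_ratio b = 0"
  shows "\<gamma> t = polygon_orbit \<phi> b (planar_proj (\<gamma> (\<tau> 0))) (t - \<tau> 0) + (0, 0, snd (snd (\<gamma> (\<tau> 0))))"
proof (rule uniform_segments)
  fix \<beta>
  assume B: "\<phi> - pi < \<beta>" "\<beta> < \<phi>"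
    "\<And>k. \<tau> (k + 1) - \<tau> k = arc_length \<phi> \<beta>" "\<And>k. \<kappa> k = sin \<beta> / sin \<phi>"
    "\<And>k. cis (\<theta> k + \<kappa> k * \<tau> k) = c (\<tau> k) * launch \<phi> \<beta>"
    "\<And>k t. t \<in> {\<tau> k..\<tau> (k + 1)} \<Longrightarrow> c t = c (\<tau> k) * arc_point (\<kappa> k) (launch \<phi> \<beta>) (t - \<tau> k)"
  interpret chord \<phi> \<beta> using phi B by unfold_locales
  have height: "z t = z (\<tau> k) + arc_height (\<kappa> k) (launch \<phi> \<beta>) (t - \<tau> k)"
    if "t \<in> {\<tau> k..\<tau> (k + 1)}" for k t
    by (rule height_on_segment[OF B(5) norm_cis]) (use B(6) that in blast)+
  define D where "D = arc_height (sin \<beta> / sin \<phi>) (launch \<phi> \<beta>) (arc_length \<phi> \<beta>)"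
  have step: "z (\<tau> (k + 1)) = z (\<tau> k) + D" for k
    using height[of "\<tau> (k + 1)" k] tau_less[of k] unfolding B(3) unfolding B(4) by (simp add: D_def)
  have "z (\<tau> (int j)) = z (\<tau> 0) + real j * D" for j
  proof (induction j)
    case (Suc j)
    have "int (Suc j) = int j + 1" by simp
    then show ?case using step[of "int j"] Suc by (simp only:) (simp add: algebra_simps)
  qed simp
  \<comment> \<open>After \<open>n\<close> arcs the height has changed by \<open>n * D\<close> and,
    the trajectory being closed, by 0.\<close>
  from this[of n] have "D = 0" using per[of 0] n by (simp add: z_def)
  then have "cos \<phi> + sin \<phi> * area_ratio \<beta> = 0"
    using arc_height_end sin_phi by (simp add: D_def)
  then have "area_ratio \<beta> = area_ratio b"
  proof -
    assume "cos \<phi> + sin \<phi> * area_ratio \<beta> = 0"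
    then have "sin \<phi> * area_ratio \<beta> = sin \<phi> * area_ratio b" using b(3) by linarith
    then show ?thesis using sin_phi by simp
  qed
  moreover have "\<bar>\<beta>\<bar> < pi" "\<bar>b\<bar> < pi" using B(1,2) b(1,2) phi by auto
  ultimately have b_eq: "b = \<beta>" using area_ratio_inj by metis
  have zt: "z (\<tau> k) = z (\<tau> 0)" for k
    by (rule int_stepwise_constant[of "\<lambda>k. z (\<tau> k)"]) (simp only: step \<open>D = 0\<close> add_0_right)
  have tau: "\<tau> k = \<tau> 0 + of_int k * L" for k
  proof -
    have "\<tau> (k + 1) - of_int (k + 1) * L = \<tau> k - of_int k * L" for k
      using B(3)[of k] by (simp add: algebra_simps)
    from int_stepwise_constant[of "\<lambda>k. \<tau> k - of_int k * L", OF this, of k] show ?thesis by simp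
  qed
  have ck: "c (\<tau> k) = c (\<tau> 0) * cis (2 * \<phi> * of_int k)" for k
  proof -
    \<comment> \<open>Rotating each vertex back by its accumulated angle gives a quantity constant
      in \<open>k\<close>, which settles negative indices as well.\<close>
    have "c (\<tau> (k + 1)) * cis (- (2 * \<phi> * of_int (k + 1))) = c (\<tau> k) * cis (- (2 * \<phi> * of_int k))" for k
    proof -
      have "cis (2 * \<phi>) * cis (- (2 * \<phi> * of_int (k + 1))) = cis (- (2 * \<phi> * of_int k))"
        by (simp add: cis_mult algebra_simps)
      then have "c (\<tau> k) * (cis (2 * \<phi>) * cis (- (2 * \<phi> * of_int (k + 1)))) = c (\<tau> k) * cis (- (2 * \<phi> * of_int k))"
        by (rule arg_cong)
      then show ?thesis unfolding c_def rot by (simp only: mult_ac)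
    qed
    from int_stepwise_constant[of "\<lambda>k. c (\<tau> k) * cis (- (2 * \<phi> * of_int k))", OF this, of k]
    have "c (\<tau> k) * cis (- (2 * \<phi> * of_int k)) * cis (2 * \<phi> * of_int k) = c (\<tau> 0) * cis (2 * \<phi> * of_int k)"
      by simp
    then show ?thesis by (simp only: mult.assoc cis_mult) simp
  qed
  define k where "k = \<lfloor>(t - \<tau> 0) / L\<rfloor>"
  have "of_int k \<le> (t - \<tau> 0) / L" "(t - \<tau> 0) / L < of_int k + 1"
    unfolding k_def by linarith+
  then have "t \<in> {\<tau> k..\<tau> (k + 1)}"
    using L_pos unfolding tau[of k] tau[of "k + 1"] by (auto simp: field_simps)
  from B(6)[OF this] height[OF this] have
    "c t = c (\<tau> k) * arc_point (sin \<beta> / sin \<phi>) (launch \<phi> \<beta>) (t - \<tau> k)"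
    "z t = z (\<tau> 0) + arc_height (sin \<beta> / sin \<phi>) (launch \<phi> \<beta>) (t - \<tau> k)"
    unfolding B(4) zt[of k] by blast+
  moreover have "t - \<tau> k = t - \<tau> 0 - of_int k * L" using tau[of k] by simp
  ultimately show ?thesis
    unfolding gamma_eq[of t] polygon_orbit_def Let_def arc_lift_def
    unfolding c_def[symmetric] z_def[symmetric] b_eq k_def[symmetric] ck[of k] by simp
qed

end

section \<open>Existence\<close>

text \<open>The covector with third coefficient \<kappa> whose heading at the lifted point is the
  velocity of the arc, obtained by solving \<open>heading\<close> for the first two
  coefficients.\<close>

definition arc_momentum :: "real \<Rightarrow> complex \<Rightarrow> complex \<Rightarrow> real \<Rightarrow> R3" where
  "arc_momentum \<kappa> w P s =
     (Re (P * (w * cis (\<kappa> * s))) + \<kappa> * Im (P * arc_point \<kappa> w s) / 2,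
      Im (P * (w * cis (\<kappa> * s))) - \<kappa> * Re (P * arc_point \<kappa> w s) / 2, \<kappa>)"

definition polygon_momentum :: "real \<Rightarrow> real \<Rightarrow> complex \<Rightarrow> real \<Rightarrow> R3" where
  "polygon_momentum \<phi> \<beta> v t =
     (let L = arc_length \<phi> \<beta>; k = \<lfloor>t / L\<rfloor>
      in arc_momentum (sin \<beta> / sin \<phi>) (launch \<phi> \<beta>) (v * cis (2 * \<phi> * of_int k)) (t - of_int k * L))"

lemma planar_proj_arc_lift [simp]: "planar_proj (arc_lift \<kappa> w P s) = P * arc_point \<kappa> w s"
  by (simp add: planar_proj_def arc_lift_def complex_eq_iff)

lemma heading_arc_momentum [simp]:
  "heading (arc_lift \<kappa> w P s) (arc_momentum \<kappa> w P s) = P * (w * cis (\<kappa> * s))"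
  by (simp add: heading_def arc_lift_def arc_momentum_def complex_eq_iff)

lemma arc_lift_has_vector_derivative:
  assumes w: "cmod w = 1"
  shows "((\<lambda>t. arc_lift \<kappa> w P (t - s)) has_vector_derivative
    (Re (P * (w * cis (\<kappa> * (t - s)))), Im (P * (w * cis (\<kappa> * (t - s)))),
     Im (cnj (arc_point \<kappa> w (t - s)) * (w * cis (\<kappa> * (t - s)))) / 2)) (at t within S)"
proof -
  note d = has_vector_derivative_mult_right[OF arc_point_shift_has_vector_derivative, of P]
  show ?thesis
    unfolding arc_lift_def
    by (intro has_vector_derivative_Pair bounded_linear.has_vector_derivative[OF bounded_linear_Re d]
        bounded_linear.has_vector_derivative[OF bounded_linear_Im d]
        arc_height_shift_has_derivative[OF w, unfolded has_real_derivative_iff_has_vector_derivative])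
qed

lemma arc_momentum_has_vector_derivative:
  "((\<lambda>t. arc_momentum \<kappa> w P (t - s)) has_vector_derivative
    (- (\<kappa> * Im (P * (w * cis (\<kappa> * (t - s)))) / 2), \<kappa> * Re (P * (w * cis (\<kappa> * (t - s)))) / 2, 0)) (at t within S)"
proof -
  define h where "h = P * (w * cis (\<kappa> * (t - s)))"
  have "((\<lambda>t. \<kappa> * (t - s)) has_real_derivative \<kappa>) (at t within S)"
    by (auto intro!: derivative_eq_intros)
  from has_vector_derivative_mult_right[OF has_vector_derivative_mult_right[OF has_vector_derivative_cis[OF this]], of P w]
  have "((\<lambda>t. P * (w * cis (\<kappa> * (t - s)))) has_vector_derivative of_real \<kappa> * (\<i> * h)) (at t within S)"
    by (simp add: h_def mult_ac)
  from bounded_linear.has_vector_derivative[OF bounded_linear_Re this]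
    bounded_linear.has_vector_derivative[OF bounded_linear_Im this]
  have dh: "((\<lambda>t. Re (P * (w * cis (\<kappa> * (t - s))))) has_real_derivative - \<kappa> * Im h) (at t within S)"
    "((\<lambda>t. Im (P * (w * cis (\<kappa> * (t - s))))) has_real_derivative \<kappa> * Re h) (at t within S)"
    unfolding has_real_derivative_iff_has_vector_derivative by simp_all
  note d = has_vector_derivative_mult_right[OF arc_point_shift_has_vector_derivative[of \<kappa> w s t S], of P]
  have dq: "((\<lambda>t. Re (P * arc_point \<kappa> w (t - s))) has_real_derivative Re h) (at t within S)"
    "((\<lambda>t. Im (P * arc_point \<kappa> w (t - s))) has_real_derivative Im h) (at t within S)"
    unfolding has_real_derivative_iff_has_vector_derivative h_def
    by (rule bounded_linear.has_vector_derivative[OF bounded_linear_Re d]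
        bounded_linear.has_vector_derivative[OF bounded_linear_Im d])+
  show ?thesis
    unfolding arc_momentum_def h_def[symmetric]
  proof (intro has_vector_derivative_Pair)
    show "((\<lambda>t. Re (P * (w * cis (\<kappa> * (t - s)))) + \<kappa> * Im (P * arc_point \<kappa> w (t - s)) / 2)
      has_vector_derivative - (\<kappa> * Im h / 2)) (at t within S)"
      unfolding has_real_derivative_iff_has_vector_derivative[symmetric]
      using DERIV_add[OF dh(1) DERIV_cdivide[OF DERIV_cmult[OF dq(2), of \<kappa>], of 2]] by simp
    show "((\<lambda>t. Im (P * (w * cis (\<kappa> * (t - s)))) - \<kappa> * Re (P * arc_point \<kappa> w (t - s)) / 2)
      has_vector_derivative \<kappa> * Re h / 2) (at t within S)"
      unfolding has_real_derivative_iff_has_vector_derivative[symmetric]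
      using DERIV_diff[OF dh(2) DERIV_cdivide[OF DERIV_cmult[OF dq(1), of \<kappa>], of 2]] by simp
  qed simp
qed

lemma hamilton_at_arc:
  assumes w: "cmod w = 1" and P: "cmod P = 1"
  shows "hamilton_at (\<lambda>(q, l). dual_norm q l) (\<lambda>t. arc_lift \<kappa> w P (t - s)) (\<lambda>t. arc_momentum \<kappa> w P (t - s)) t"
proof (rule hamilton_atI)
  show "cmod (P * (w * cis (\<kappa> * (t - s)))) = 1" using w P by (simp add: norm_mult)
  show "((\<lambda>t. arc_lift \<kappa> w P (t - s)) has_vector_derivative
     (Re (P * (w * cis (\<kappa> * (t - s)))), Im (P * (w * cis (\<kappa> * (t - s)))),
      Im (cnj (Complex (Re (P * arc_point \<kappa> w (t - s))) (Im (P * arc_point \<kappa> w (t - s)))) * (P * (w * cis (\<kappa> * (t - s))))) / 2)) (at t)"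
    unfolding complex_surj cnj_unit_cancel[OF P] by (rule arc_lift_has_vector_derivative[OF w])
qed (rule arc_momentum_has_vector_derivative arc_lift_def arc_momentum_def)+

lemma hamilton_at_transform:
  assumes "hamilton_at H q p t" "open S" "t \<in> S" "\<And>s. s \<in> S \<Longrightarrow> q s = q' s" "\<And>s. s \<in> S \<Longrightarrow> p s = p' s"
  shows "hamilton_at H q' p' t"
proof -
  from assms(1) obtain a b where "(q has_vector_derivative a) (at t)" "(p has_vector_derivative b) (at t)"
    and H: "(H has_derivative (\<lambda>(u, w). a \<bullet> w - b \<bullet> u)) (at (q t, p t))"
    unfolding hamilton_at_def by blast
  then have "(q' has_vector_derivative a) (at t)" "(p' has_vector_derivative b) (at t)"
    using has_vector_derivative_transform_within_open[OF _ assms(2,3)] assms(4,5) by blast+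
  then show ?thesis
    using H unfolding hamilton_at_def assms(4)[OF assms(3)] assms(5)[OF assms(3)] by blast
qed

section \<open>The model orbit is a billiard trajectory\<close>

locale closed_chord = chord +
  fixes v :: complex
  assumes area: "cos \<phi> + sin \<phi> * area_ratio \<beta> = 0" and v: "cmod v = 1"
begin

abbreviation "vertex k \<equiv> v * cis (2 * \<phi> * of_int k)"

abbreviation "\<gamma> \<equiv> polygon_orbit \<phi> \<beta> v"

abbreviation "p \<equiv> polygon_momentum \<phi> \<beta> v"

lemma vertex_Suc: "vertex (k + 1) = vertex k * cis (2 * \<phi>)"
  by (simp add: cis_mult algebra_simps)

lemma cmod_vertex: "cmod (vertex k) = 1"
  using v by (simp add: norm_mult)

lemma floor_segment: "of_int k * L \<le> t \<Longrightarrow> t < of_int (k + 1) * L \<Longrightarrow> \<lfloor>t / L\<rfloor> = k"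
  using L_pos by (intro floor_unique) (simp_all add: field_simps)

lemma momentum_segment:
  "of_int k * L \<le> t \<Longrightarrow> t < of_int (k + 1) * L \<Longrightarrow> p t = arc_momentum \<kappa> w (vertex k) (t - of_int k * L)"
  using floor_segment[of k t] by (simp add: polygon_momentum_def)

text \<open>Unlike for the momentum, the right end may be included: the floor has already moved on
  to the next arc there, but that arc starts where this one ends, by \<open>arc_end\<close> and the
  vanishing height.\<close>

lemma orbit_segment:
  assumes "of_int k * L \<le> t" "t \<le> of_int (k + 1) * L"
  shows "\<gamma> t = arc_lift \<kappa> w (vertex k) (t - of_int k * L)"
proof (cases "t = of_int (k + 1) * L")
  case True
  have "t / L = of_int (k + 1)" using True L_pos by simp
  then have "\<lfloor>t / L\<rfloor> = k + 1" by (simp only: floor_of_int)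
  then have "\<gamma> t = arc_lift \<kappa> w (vertex (k + 1)) (t - of_int (k + 1) * L)"
    by (simp only: polygon_orbit_def Let_def)
  also have "\<dots> = arc_lift \<kappa> w (vertex (k + 1)) 0"
    using True by simp
  also have "\<dots> = arc_lift \<kappa> w (vertex k) L"
    using arc_height_end area unfolding arc_lift_def vertex_Suc arc_end by simp
  also have "L = t - of_int k * L"
    using True by (simp add: algebra_simps)
  finally show ?thesis .
next
  case False
  then show ?thesis using floor_segment[of k t] assms by (simp add: polygon_orbit_def)
qed

lemma orbit_vertex: "planar_proj (\<gamma> (of_int k * L)) = vertex k"
  using orbit_segment[of k "of_int k * L"] L_pos by (simp add: mult_right_mono)

lemma segment_exists: "\<exists>k :: int. of_int k * L \<le> t \<and> t < of_int (k + 1) * L"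
proof -
  have "of_int \<lfloor>t / L\<rfloor> \<le> t / L" "t / L < of_int (\<lfloor>t / L\<rfloor> + 1)" by linarith+
  then show ?thesis
    unfolding pos_le_divide_eq[OF L_pos] pos_divide_less_eq[OF L_pos] by blast
qed

lemma continuous_on_segment: "continuous_on {of_int k * L..of_int (k + 1) * L} \<gamma>"
proof -
  have "continuous_on {of_int k * L..of_int (k + 1) * L} (\<lambda>t. arc_lift \<kappa> w (vertex k) (t - of_int k * L))"
    unfolding continuous_on_eq_continuous_within
    by (intro ballI has_vector_derivative_continuous[OF arc_lift_has_vector_derivative]) simp
  then show ?thesis
    by (subst continuous_on_cong[OF refl orbit_segment]) auto
qed

lemma continuous_orbit: "continuous_on UNIV \<gamma>"
proof -
  have "isCont \<gamma> t" for t
  proof -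
    obtain k where k: "of_int k * L \<le> t" "t < of_int (k + 1) * L" using segment_exists by blast
    have le: "of_int (k - 1) * L < of_int k * L" "of_int k * L \<le> of_int (k + 1) * L"
      using L_pos by (auto simp: algebra_simps)
    \<comment> \<open>\<open>t\<close> may be the left end of segment \<open>k\<close>, so the
      preceding segment is attached to make it an interior point.\<close>
    have "continuous_on ({of_int (k - 1) * L..of_int k * L} \<union> {of_int k * L..of_int (k + 1) * L}) \<gamma>"
      using continuous_on_segment[of "k - 1"] continuous_on_segment[of k]
      by (intro continuous_on_closed_Un) auto
    also have "{of_int (k - 1) * L..of_int k * L} \<union> {of_int k * L..of_int (k + 1) * L} = {of_int (k - 1) * L..of_int (k + 1) * L}"
      using le by (intro ivl_disj_un_two_touch) auto
    finally show ?thesis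
      using k le by (elim continuous_on_interior) (auto simp: interior_atLeastAtMost_real)
  qed
  then show ?thesis by (simp add: continuous_at_imp_continuous_on)
qed

lemma orbit_in_cylinder: "\<gamma> t \<in> std_cylinder"
proof -
  obtain k where k: "of_int k * L \<le> t" "t < of_int (k + 1) * L" using segment_exists by blast
  then have "cmod (arc_point \<kappa> w (t - of_int k * L)) \<le> 1"
    by (intro arc_in_disc) (auto simp: algebra_simps)
  then show ?thesis
    unfolding planar_proj_cylinder using k by (simp add: orbit_segment norm_mult v)
qed

lemma finite_reflections: "finite (range (\<lambda>k. of_int k * L) \<inter> {s..u})"
proof (rule finite_subset)
  show "range (\<lambda>k. of_int k * L) \<inter> {s..u} \<subseteq> (\<lambda>k. of_int k * L) ` {\<lfloor>s / L\<rfloor>..\<lceil>u / L\<rceil>}"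
  proof
    fix t assume "t \<in> range (\<lambda>k. of_int k * L) \<inter> {s..u}"
    then obtain k where k: "t = of_int k * L" "s \<le> of_int k * L" "of_int k * L \<le> u" by auto
    then have "s / L \<le> of_int k" "of_int k \<le> u / L" using L_pos by (auto simp: field_simps)
    then have "k \<in> {\<lfloor>s / L\<rfloor>..\<lceil>u / L\<rceil>}" by (simp add: floor_le_iff le_ceiling_iff)
    then show "t \<in> (\<lambda>k. of_int k * L) ` {\<lfloor>s / L\<rfloor>..\<lceil>u / L\<rceil>}" using k by blast
  qed
qed simp

lemma geodesic_segments:
  assumes "t \<notin> range (\<lambda>k. of_int k * L)"
  shows "dual_norm (\<gamma> t) (p t) = 1 \<and> hamilton_at (\<lambda>(q, l). dual_norm q l) \<gamma> p t"
proof -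
  obtain k where k: "of_int k * L \<le> t" "t < of_int (k + 1) * L" using segment_exists by blast
  moreover have "of_int k * L \<noteq> t" using assms by auto
  ultimately have t: "t \<in> {of_int k * L<..<of_int (k + 1) * L}" by simp
  have eq: "arc_lift \<kappa> w (vertex k) (s - of_int k * L) = \<gamma> s"
     "arc_momentum \<kappa> w (vertex k) (s - of_int k * L) = p s" if "s \<in> {of_int k * L<..<of_int (k + 1) * L}" for s
    using that orbit_segment[of k s] momentum_segment[of k s] by simp_all
  have "hamilton_at (\<lambda>(q, l). dual_norm q l) \<gamma> p t"
    by (rule hamilton_at_transform[OF hamilton_at_arc _ t eq]) (simp_all add: cmod_vertex)
  moreover have "dual_norm (\<gamma> t) (p t) = 1"
    unfolding dual_norm_heading eq[OF t, symmetric] heading_arc_momentum by (simp add: norm_mult v)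
  ultimately show ?thesis by simp
qed

lemma tendsto_arc_momentum:
  "((\<lambda>t. arc_momentum \<kappa>' w' P (t - s)) \<longlongrightarrow> arc_momentum \<kappa>' w' P (t0 - s)) (at t0 within S)"
  using has_vector_derivative_continuous[OF arc_momentum_has_vector_derivative]
  by (simp add: continuous_within)

text \<open>Relative to the vertex the two directions have angles
  \<open>\<beta> - \<phi> + pi / 2\<close> and \<open>\<phi> - \<beta> + pi / 2\<close>. They share
  the tangential part \<open>cos (\<phi> - \<beta>)\<close> and have opposite radial parts, nonzero
  because \<open>sin (\<phi> - \<beta>) > 0\<close>.\<close>

lemma reflection_at_vertex:
  fixes k :: int
  defines "t \<equiv> of_int k * L"
  shows "\<exists>l_in l_out. (p \<longlongrightarrow> l_in) (at_left t) \<and> (p \<longlongrightarrow> l_out) (at_right t) \<and>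
      dual_norm (\<gamma> t) l_in = 1 \<and> dual_norm (\<gamma> t) l_out = 1 \<and> l_in \<noteq> l_out \<and>
      l_in - l_out \<in> annihilator (tangent_vectors (frontier std_cylinder) (\<gamma> t))"
proof -
  define s where "s = of_int (k - 1) * L"
  have st: "s < t" "t < of_int (k + 1) * L" "t - s = L" using L_pos by (auto simp: s_def t_def algebra_simps)
  define l_in where "l_in = arc_momentum \<kappa> w (vertex (k - 1)) L"
  define l_out where "l_out = arc_momentum \<kappa> w (vertex k) 0"
  have lim: "(p \<longlongrightarrow> l_in) (at_left t)"
  proof (rule Lim_transform_eventually)
    show "((\<lambda>t. arc_momentum \<kappa> w (vertex (k - 1)) (t - s)) \<longlongrightarrow> l_in) (at_left t)"
      using tendsto_arc_momentum[of \<kappa> w "vertex (k - 1)" s t] st by (simp add: l_in_def)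
    show "\<forall>\<^sub>F r in at_left t. arc_momentum \<kappa> w (vertex (k - 1)) (r - s) = p r"
      using eventually_at_left_real[OF st(1)]
      by eventually_elim (use momentum_segment[of "k - 1"] in \<open>simp add: s_def t_def\<close>)
  qed
  have lim': "(p \<longlongrightarrow> l_out) (at_right t)"
  proof (rule Lim_transform_eventually)
    show "((\<lambda>r. arc_momentum \<kappa> w (vertex k) (r - t)) \<longlongrightarrow> l_out) (at_right t)"
      using tendsto_arc_momentum[of \<kappa> w "vertex k" t t] by (simp add: l_out_def)
    show "\<forall>\<^sub>F r in at_right t. arc_momentum \<kappa> w (vertex k) (r - t) = p r"
      using eventually_at_right_real[OF st(2)]
      by eventually_elim (use momentum_segment[of k] in \<open>simp add: t_def\<close>)
  qed
  have g: "\<gamma> t = arc_lift \<kappa> w (vertex (k - 1)) L" "\<gamma> t = arc_lift \<kappa> w (vertex k) 0"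
    using orbit_segment[of "k - 1" t] orbit_segment[of k t] st by (simp_all add: s_def t_def)
  have h: "heading (\<gamma> t) l_in = vertex (k - 1) * (w * cis (2 * \<beta>))"
    unfolding g(1) l_in_def heading_arc_momentum curvature_length ..
  also have "\<dots> = vertex (k - 1) * cis (2 * \<phi> + (\<beta> - \<phi> + pi / 2))"
    unfolding cis_mult by (rule arg_cong[where f = "\<lambda>x. vertex (k - 1) * cis x"]) simp
  also have "\<dots> = vertex k * cis (\<beta> - \<phi> + pi / 2)"
  proof -
    have "vertex k = vertex (k - 1) * cis (2 * \<phi>)" using vertex_Suc[of "k - 1"] by simp
    then show ?thesis by (simp only: mult.assoc cis_mult add.assoc)
  qed
  finally have h_in: "heading (\<gamma> t) l_in = vertex k * cis (\<beta> - \<phi> + pi / 2)" .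
  have "heading (\<gamma> t) l_out = vertex k * (w * cis 0)"
    unfolding g(2) l_out_def heading_arc_momentum by simp
  also have "\<dots> = vertex k * cis (\<phi> - \<beta> + pi / 2)"
    by (simp add: algebra_simps)
  finally have h_out: "heading (\<gamma> t) l_out = vertex k * cis (\<phi> - \<beta> + pi / 2)" .
  have pl: "planar_proj (\<gamma> t) = vertex k" unfolding t_def by (rule orbit_vertex)
  have "l_in - l_out \<in> annihilator (tangent_vectors (frontier std_cylinder) (\<gamma> t))"
  proof (subst annihilator_cylinder_heading)
    show "cmod (planar_proj (\<gamma> t)) = 1" unfolding pl by (rule cmod_vertex)
    have "cos (\<beta> - \<phi>) = cos (\<phi> - \<beta>)" using cos_minus[of "\<beta> - \<phi>"] by simp
    then show "snd (snd l_in) = snd (snd l_out) \<and>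
        Im (cnj (planar_proj (\<gamma> t)) * heading (\<gamma> t) l_in) = Im (cnj (planar_proj (\<gamma> t)) * heading (\<gamma> t) l_out)"
      unfolding h_in h_out pl cnj_unit_cancel[OF cmod_vertex]
      by (simp add: l_in_def l_out_def arc_momentum_def sin_add)
  qed
  moreover have "l_in \<noteq> l_out"
  proof
    assume eq: "l_in = l_out"
    then have "vertex k * cis (\<beta> - \<phi> + pi / 2) = vertex k * cis (\<phi> - \<beta> + pi / 2)"
      unfolding h_in[symmetric] h_out[symmetric] eq by simp
    then have "cis (\<beta> - \<phi> + pi / 2) = cis (\<phi> - \<beta> + pi / 2)"
      using cmod_vertex[of k] by auto
    then have "cos (\<beta> - \<phi> + pi / 2) = cos (\<phi> - \<beta> + pi / 2)"
      by (metis cis.sel(1))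
    then have "sin (\<beta> - \<phi>) = sin (\<phi> - \<beta>)" by (simp add: cos_add)
    then have "sin (\<phi> - \<beta>) = 0" using sin_minus[of "\<phi> - \<beta>"] by simp
    moreover have "sin (\<phi> - \<beta>) > 0" using beta by (intro sin_gt_zero) auto
    ultimately show False by simp
  qed
  moreover have "dual_norm (\<gamma> t) l_in = 1" "dual_norm (\<gamma> t) l_out = 1"
    unfolding dual_norm_heading h_in h_out by (simp_all add: norm_mult v)
  ultimately show ?thesis using lim lim' by blast
qed

lemma billiard_polygon_orbit:
  "billiard_trajectory std_cylinder (range (\<lambda>k. of_int k * L)) \<gamma>"
  unfolding billiard_trajectory_def
proof (intro conjI exI[of _ p] allI impI ballI)
  fix t assume "t \<in> range (\<lambda>k :: int. of_int k * L)"
  then obtain k :: int where t: "t = of_int k * L" by blast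
  show "\<gamma> t \<in> frontier std_cylinder"
    unfolding frontier_cylinder t orbit_vertex by (rule cmod_vertex)
  show "\<exists>l_in l_out. (p \<longlongrightarrow> l_in) (at_left t) \<and> (p \<longlongrightarrow> l_out) (at_right t) \<and>
      dual_norm (\<gamma> t) l_in = 1 \<and> dual_norm (\<gamma> t) l_out = 1 \<and> l_in \<noteq> l_out \<and>
      l_in - l_out \<in> annihilator (tangent_vectors (frontier std_cylinder) (\<gamma> t))"
    unfolding t by (rule reflection_at_vertex)
qed (use continuous_orbit orbit_in_cylinder finite_reflections geodesic_segments in auto)

lemma circular_segment_orbit:
  "circular_segment (planar_proj \<circ> \<gamma>) (of_int k * L) (of_int (k + 1) * L)"
proof -
  define s where "s = of_int k * L"
  obtain a where a: "v = cis a" using v 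
    by (cases "v = 0") (auto simp: cis_Arg sgn_div_norm intro: that[of "Arg v"])
  \<comment> \<open>Angle of the vertex plus launch angle; \<open>\<kappa> * s\<close> is subtracted
    because \<open>circular_segment\<close> counts the phase from time 0, not from the start of the
    arc.\<close>
  define \<theta> where "\<theta> = a + 2 * \<phi> * of_int k + (\<phi> + pi / 2 - \<beta>) - \<kappa> * s"
  have "((planar_proj \<circ> \<gamma>) has_vector_derivative cis (\<theta> + \<kappa> * t)) (at t within {s..of_int (k + 1) * L})"
    if t: "t \<in> {s..of_int (k + 1) * L}" for t
  proof (rule has_vector_derivative_transform[OF t])
    show "(planar_proj \<circ> \<gamma>) r = vertex k * arc_point \<kappa> w (r - s)" if "r \<in> {s..of_int (k + 1) * L}" for r
      using that orbit_segment[of k r] by (simp add: s_def)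
    have "vertex k * (w * cis (\<kappa> * (t - s))) = cis (\<theta> + \<kappa> * t)"
      unfolding a cis_mult \<theta>_def by (rule arg_cong[where f = cis]) (simp add: algebra_simps diff_divide_distrib)
    then show "((\<lambda>r. vertex k * arc_point \<kappa> w (r - s)) has_vector_derivative cis (\<theta> + \<kappa> * t)) (at t within {s..of_int (k + 1) * L})"
      using has_vector_derivative_mult_right[OF arc_point_shift_has_vector_derivative[of \<kappa> w s t], of "vertex k"] by simp
  qed
  then show ?thesis unfolding circular_segment_def s_def by blast
qed

end

section \<open>Time shifts, rotations modulo n and the final assembly\<close>

lemma polygon_orbit_shift:
  assumes "arc_length \<phi> \<beta> > 0"
  shows "polygon_orbit \<phi> \<beta> v (t + of_int j * arc_length \<phi> \<beta>) = polygon_orbit \<phi> \<beta> (v * cis (2 * \<phi> * of_int j)) t"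
proof -
  let ?L = "arc_length \<phi> \<beta>"
  have "(t + of_int j * ?L) / ?L = t / ?L + of_int j" using assms by (simp add: field_simps)
  then have "\<lfloor>(t + of_int j * ?L) / ?L\<rfloor> = \<lfloor>t / ?L\<rfloor> + j" by simp
  then show ?thesis
    by (simp add: polygon_orbit_def Let_def mult.assoc cis_mult algebra_simps)
qed

text \<open>Serves to bring the half rotation into (0, pi), and to bring vertex numbers into the
  index range of the polygon.\<close>

lemma cis_int_mod:
  assumes "n > 0"
  shows "cis (2 * pi * of_int (i mod int n) / real n) = cis (2 * pi * of_int i / real n)"
proof -
  have "of_int i = real n * of_int (i div int n) + real_of_int (i mod int n)"
    by (metis mult_div_mod_eq of_int_add of_int_mult of_int_of_nat_eq)
  then have "2 * pi * of_int i / real n = 2 * pi * of_int (i mod int n) / real n + 2 * pi * of_int (i div int n)"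
    using assms by (simp add: field_simps)
  then have "cis (2 * pi * of_int i / real n) = cis (2 * pi * of_int (i mod int n) / real n) * cis (2 * pi * of_int (i div int n))"
    by (simp only: cis_mult)
  also have "cis (2 * pi * of_int (i div int n)) = 1" by (rule cis_multiple_2pi) simp
  finally show ?thesis by simp
qed

theorem lemma5p14:
  fixes n :: nat and m :: int and V :: "complex set"
  assumes "n \<ge> 2" and "coprime m (int n)" and "inscribed_regular_ngon n V"
  shows "\<exists>\<gamma>. ngon_trajectory n m V \<gamma> \<and>
           (\<forall>\<gamma>'. ngon_trajectory n m V \<gamma>' \<longrightarrow>
              (\<exists>s h. \<forall>t. \<gamma>' t = \<gamma> (t + s) + (0, 0, h)))"
proof -
  have n: "n > 0" using assms(1) by simp
  obtain v where v: "cmod v = 1" and V: "V = (\<lambda>k. cis (2 * pi * real k / real n) * v) ` {..<n}"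
    using assms(3) unfolding inscribed_regular_ngon_def by blast
  \<comment> \<open>Reducing \<open>m\<close> modulo \<open>n\<close> puts \<phi> in (0, pi):
    coprimality and \<open>n \<ge> 2\<close> exclude remainder 0, for which the chord would shrink
    to a point.\<close>
  define \<phi> where "\<phi> = pi * of_int (m mod int n) / real n"
  have "m mod int n \<noteq> 0"
  proof
    assume "m mod int n = 0"
    then have "int n dvd m" by (simp add: dvd_eq_mod_eq_0)
    then have "int n dvd 1" using assms(2) by (meson coprime_def dvd_refl)
    then show False using assms(1) by simp
  qed
  moreover have "0 \<le> m mod int n" "m mod int n < int n" using n by simp_all
  ultimately have mod: "0 < m mod int n" "m mod int n < int n" by auto
  have phi: "0 < \<phi>" "\<phi> < pi"
  proof -
    show "0 < \<phi>" using mod n by (simp add: \<phi>_def)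
    have "real_of_int (m mod int n) < real n" using mod(2) by linarith
    then show "\<phi> < pi" using n by (simp add: \<phi>_def field_simps)
  qed
  have rot: "cis (2 * \<phi>) = cis (2 * pi * of_int m / real n)"
    using cis_int_mod[OF n, of m] by (simp add: \<phi>_def mult.assoc)
  have rots: "cis (2 * \<phi> * of_int j) = cis (2 * pi * of_int (m * j) / real n)" for j :: int
  proof -
    \<comment> \<open>Since \<phi> contains the remainder of \<open>m\<close> rather than
      \<open>m\<close>, the angles themselves differ; the identity \<open>rot\<close> is raised to
      an integer power instead.\<close>
    have "cis (2 * \<phi> * of_int j) = cis (2 * \<phi>) powi j" by (simp add: cis_power_int mult.commute)
    also have "\<dots> = cis (2 * pi * of_int (m * j) / real n)"
      unfolding rot by (simp add: cis_power_int mult_ac)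
    finally show ?thesis .
  qed
  obtain \<beta> where b: "\<phi> - pi < \<beta>" "\<beta> < \<phi>" "cos \<phi> + sin \<phi> * area_ratio \<beta> = 0"
    using area_ratio_solution[OF phi] .
  interpret closed_chord \<phi> \<beta> v
    by unfold_locales (rule phi b v)+
  define L where "L = arc_length \<phi> \<beta>"
  have L: "L > 0" unfolding L_def by (rule L_pos)
  let ?\<gamma> = "polygon_orbit \<phi> \<beta> v"
  have "ngon_trajectory n m V ?\<gamma>"
    unfolding ngon_trajectory_def
  proof (intro exI[of _ "\<lambda>k. of_int k * L"] exI[of _ "real n * L"] conjI allI)
    show "strict_mono (\<lambda>k :: int. of_int k * L)" using L by (simp add: strict_mono_def)
    show "billiard_trajectory std_cylinder (range (\<lambda>k :: int. of_int k * L)) ?\<gamma>"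
      unfolding L_def by (rule billiard_polygon_orbit)
    show "real n * L > 0" using n L by simp
    show "?\<gamma> (t + real n * L) = ?\<gamma> t" for t
    proof -
      have "2 * pi * of_int (m * int n) / real n = 2 * pi * of_int m" using n by simp
      then have "cis (2 * \<phi> * of_int (int n)) = cis (2 * pi * of_int m)"
        unfolding rots by (rule arg_cong)
      also have "\<dots> = 1" by (rule cis_multiple_2pi) simp
      finally show ?thesis
        using polygon_orbit_shift[OF L_pos, of v t "int n"] by (simp add: L_def)
    qed
    show "of_int (k + int n) * L = of_int k * L + real n * L" for k
      by (simp add: algebra_simps)
    fix k :: int
    show "circular_segment (planar_proj \<circ> ?\<gamma>) (of_int k * L) (of_int (k + 1) * L)"
      unfolding L_def by (rule circular_segment_orbit)
    have "planar_proj (?\<gamma> (of_int k * L)) = cis (2 * pi * of_int ((m * k) mod int n) / real n) * v"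
      unfolding L_def orbit_vertex rots cis_int_mod[OF n] by (rule mult.commute)
    also have "\<dots> = cis (2 * pi * real (nat ((m * k) mod int n)) / real n) * v"
      using n by simp
    also have "\<dots> \<in> V"
      unfolding V using n by (intro imageI) (simp add: nat_less_iff)
    finally show "planar_proj (?\<gamma> (of_int k * L)) \<in> V" .
    show "planar_proj (?\<gamma> (of_int (k + 1) * L)) = cis (2 * pi * of_int m / real n) * planar_proj (?\<gamma> (of_int k * L))"
      unfolding L_def orbit_vertex vertex_Suc rot by (rule mult.commute)
  qed
  moreover have "\<exists>s h. \<forall>t. \<gamma>' t = ?\<gamma> (t + s) + (0, 0, h)" if traj: "ngon_trajectory n m V \<gamma>'" for \<gamma>'
  proof -
    from traj obtain \<tau> T where mono: "strict_mono (\<tau> :: int \<Rightarrow> real)"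
      and bill: "billiard_trajectory std_cylinder (range \<tau>) \<gamma>'"
      and per: "\<And>t. \<gamma>' (t + T) = \<gamma>' t" "\<And>k. \<tau> (k + int n) = \<tau> k + T"
      and circ: "\<And>k. circular_segment (planar_proj \<circ> \<gamma>') (\<tau> k) (\<tau> (k + 1))"
      and vert: "\<And>k. planar_proj (\<gamma>' (\<tau> k)) \<in> V"
      and step: "\<And>k. planar_proj (\<gamma>' (\<tau> (k + 1))) = cis (2 * pi * of_int m / real n) * planar_proj (\<gamma>' (\<tau> k))"
      unfolding ngon_trajectory_def by blast
    from bill obtain p where cont: "continuous_on UNIV \<gamma>'" and cyl: "range \<gamma>' \<subseteq> std_cylinder"
      and geo: "\<And>t. t \<notin> range \<tau> \<Longrightarrow> dual_norm (\<gamma>' t) (p t) = 1 \<and> hamilton_at (\<lambda>(q, l). dual_norm q l) \<gamma>' p t"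
      and refl: "\<And>t. t \<in> range \<tau> \<Longrightarrow> \<gamma>' t \<in> frontier std_cylinder \<and>
           (\<exists>l_in l_out.
              (p \<longlongrightarrow> l_in) (at_left t) \<and> (p \<longlongrightarrow> l_out) (at_right t) \<and>
              dual_norm (\<gamma>' t) l_in = 1 \<and> dual_norm (\<gamma>' t) l_out = 1 \<and> l_in \<noteq> l_out \<and>
              l_in - l_out \<in> annihilator (tangent_vectors (frontier std_cylinder) (\<gamma>' t)))"
      unfolding billiard_trajectory_def by blast
    have "\<forall>k. \<exists>\<kappa> \<theta>. \<forall>t \<in> {\<tau> k..\<tau> (k + 1)}.
        ((planar_proj \<circ> \<gamma>') has_vector_derivative cis (\<theta> + \<kappa> * t)) (at t within {\<tau> k..\<tau> (k + 1)})"
      using circ unfolding circular_segment_def by blast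
    then obtain \<kappa>' \<theta>' where seg: "\<forall>k. \<forall>t \<in> {\<tau> k..\<tau> (k + 1)}.
        ((planar_proj \<circ> \<gamma>') has_vector_derivative cis (\<theta>' k + \<kappa>' k * t)) (at t within {\<tau> k..\<tau> (k + 1)})"
      by metis
    interpret traj: ngon_billiard \<phi> n \<tau> \<gamma>' p \<theta>' \<kappa>'
    proof
      show "\<gamma>' (\<tau> k) \<in> frontier std_cylinder" for k using refl[of "\<tau> k"] by blast
      show "\<exists>l_in l_out.
              (p \<longlongrightarrow> l_in) (at_left (\<tau> k)) \<and> (p \<longlongrightarrow> l_out) (at_right (\<tau> k)) \<and>
              l_in \<noteq> l_out \<and> l_in - l_out \<in> annihilator (tangent_vectors (frontier std_cylinder) (\<gamma>' (\<tau> k)))" for k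
        using refl[of "\<tau> k"] by blast
      show "planar_proj (\<gamma>' (\<tau> (k + 1))) = cis (2 * \<phi>) * planar_proj (\<gamma>' (\<tau> k))" for k
        unfolding rot by (rule step)
    qed (use phi n mono cont cyl geo seg per in auto)
    obtain i where i: "planar_proj (\<gamma>' (\<tau> 0)) = cis (2 * pi * real i / real n) * v"
      using vert[of 0] unfolding V by blast
    obtain a b where ab: "a * m + b * int n = 1"
      using bezout_int[of m "int n"] assms(2) by auto
    \<comment> \<open>By the Bezout relation \<open>a\<close> inverts \<open>m\<close> modulo
      \<open>n\<close>, so after \<open>j\<close> arcs the model orbit sits at the polygon vertex
      with index \<open>i\<close>, where the given trajectory starts.\<close>
    define j where "j = int i * a"
    have "m * j mod int n = int i mod int n"
    proof -
      have "m * j = int i * (a * m + b * int n) - (int i * b) * int n"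
        unfolding j_def by (simp add: algebra_simps)
      then have "m * j = int i + (- (int i * b)) * int n" unfolding ab by simp
      then show ?thesis by (simp only: mod_mult_self1)
    qed
    then have "cis (2 * \<phi> * of_int j) = cis (2 * pi * real i / real n)"
      unfolding rots using cis_int_mod[OF n, of "m * j"] cis_int_mod[OF n, of "int i"] by simp
    then have start: "planar_proj (\<gamma>' (\<tau> 0)) = v * cis (2 * \<phi> * of_int j)"
      using i by simp
    have "\<gamma>' t = ?\<gamma> (t + (of_int j * L - \<tau> 0)) + (0, 0, snd (snd (\<gamma>' (\<tau> 0))))" for t
    proof -
      have "t + (of_int j * L - \<tau> 0) = (t - \<tau> 0) + of_int j * L" by simp
      then show ?thesis
        using traj.eq_polygon_orbit[OF b, of t] polygon_orbit_shift[OF L_pos, of v "t - \<tau> 0" j]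
        unfolding start by (simp only: L_def)
    qed
    then show ?thesis by blast
  qed
  ultimately show ?thesis by blast
qed

end
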